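(* Let $\theta\in T_\rho$ (in particular $\theta$ is finite and nonzero) and set $\tilde a_N(\theta):=\frac{1}{\sqrt N}+\sqrt{a_N(\theta)}$. There exists a constant $K(\theta)>0$, independent of $N$, of $d$ and of $f$, such that for every $d\ge 1$, every $N\ge d$ and every bounded measurable function $f:\mathbb{R}^N\to\mathbb{R}$, $$\big|\langle f(g)\rangle-\langle f(g)\rangle_d\big|\le K(\theta)\,\|f\|_\infty\,\tilde a_N(\theta).$$
   Context: Eigenvalues. Fix $\tilde\gamma>0$. For each $N\ge1$ let $\gamma_1=\gamma^{(N)}_1,\dots,\gamma_N=\gamma_N^{(N)}$ be deterministic real numbers in $[0,\tilde\gamma]$ such that the empirical measures $N^{-1}\sum_{i\le N}\delta_{\gamma_i^{(N)}}$ converge, as $N\to\infty$, in the 1-Wasserstein metric to a probability measure $\rho$ on $[0,\tilde\gamma]$. The array of eigenvalues, $\tilde\gamma$ and $\rho$ are fixed; constants may depend on them. Model. For $g\in\mathbb{R}^N\setminus\{0\}$ let $H_N(g):=N\sum_{i\le N}\gamma_i\, g_i^2/\|g\|^2$ and $h_N:=N^{-1}H_N$. Let $G$ be the standard normal measure on $\mathbb{R}^N$. For $\theta\in\mathbb{R}$ the Gibbs mean is $\langle f(g)\rangle=\langle f(g)\rangle_\theta:=\frac{1}{Z_N}\int_{\mathbb{R}^N}f(g)\,e^{\theta H_N(g)}\,dG(g)$ with $Z_N:=\int e^{\theta H_N}dG$. Transforms. For $z\in\mathbb{R}\setminus[0,\tilde\gamma]$ let $S_\rho(z):=\int\frac{\rho(d\gamma)}{z-\gamma}$,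 $S_{\max}:=\lim_{z\downarrow\tilde\gamma}S_\rho(z)\in(0,+\infty]$, $S_{\min}:=\lim_{z\uparrow0}S_\rho(z)\in[-\infty,0)$. $S_\rho$ is a bijection from $\mathbb{R}\setminus[0,\tilde\gamma]$ onto $(S_{\min},S_{\max})\setminus\{0\}$ with inverse $K_\rho$; the R-transform is $R_\rho(x):=K_\rho(x)-1/x$ on $(S_{\min},S_{\max})\setminus\{0\}$. Put $T_\rho:=(S_{\min}/2,S_{\max}/2)\setminus\{0\}$ and, for $\theta\in T_\rho$, $v(\theta):=R_\rho(2\theta)$. Rate. $a_N(\theta):=\big\langle(h_N-v(\theta))^2\big\rangle_\theta$. Decoupled measure. For $d\le N$ let $\bar g:=(g_1,\dots,g_{d-1},g_{d+1},\dots,g_N)\in\mathbb{R}^{N-1}$ and $$H_d(g):=N\sum_{i\le N,\ i\ne d}\gamma_i\frac{g_i^2}{\|\bar g\|^2}-(v(\theta)-\gamma_d)g_d^2$$ (an empty sum is $0$). $\langle\cdot\rangle_d$ is the Gibbs mean with Hamiltonian $H_d$ at the same $\theta$, i.e. $\langle f\rangle_d:=\int f e^{\theta H_d}dG\big/\int e^{\theta H_d}dG$. *)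

theory Defs
  imports "HOL-Probability.Probability"
begin

text \<open>The Wasserstein distance takes values in the extended non-negative reals, so that no
  integrability convention interferes with the infimum over couplings.\<close>

definition couplings :: "real measure \<Rightarrow> real measure \<Rightarrow> (real \<times> real) measure set" where
  "couplings \<mu> \<nu> = {\<pi>. sets \<pi> = sets (borel \<Otimes>\<^sub>M borel) \<and>
                        distr \<pi> borel fst = \<mu> \<and> distr \<pi> borel snd = \<nu>}"

definition wasserstein1 :: "real measure \<Rightarrow> real measure \<Rightarrow> ennreal" where
  "wasserstein1 \<mu> \<nu> = (INF \<pi>\<in>couplings \<mu> \<nu>. \<integral>\<^sup>+p. ennreal \<bar>fst p - snd p\<bar> \<partial>\<pi>)"

definition empirical_measure :: "(nat \<Rightarrow> nat \<Rightarrow> real) \<Rightarrow> nat \<Rightarrow> real measure" where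
  "empirical_measure \<gamma> N = distr (uniform_count_measure {1..N}) borel (\<gamma> N)"

text \<open>Points of \<open>\<real>\<^sup>N\<close> are functions on \<open>{1..N}\<close>, extended by \<open>undefined\<close> outside of it.
  The number \<open>\<gamma> N i\<close> is the \<open>i\<close>-th eigenvalue of the \<open>N\<close>-th row of the array.\<close>

abbreviation RN :: "nat \<Rightarrow> (nat \<Rightarrow> real) measure" where
  "RN N \<equiv> Pi\<^sub>M {1..N} (\<lambda>_. borel)"

definition gauss :: "nat \<Rightarrow> (nat \<Rightarrow> real) measure" where
  "gauss N = Pi\<^sub>M {1..N} (\<lambda>_. std_normal_distribution)"

definition gibbs_mean ::
  "nat \<Rightarrow> ((nat \<Rightarrow> real) \<Rightarrow> real) \<Rightarrow> real \<Rightarrow> ((nat \<Rightarrow> real) \<Rightarrow> real) \<Rightarrow> real" where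
  "gibbs_mean N H \<theta> f =
     (\<integral>g. f g * exp (\<theta> * H g) \<partial>gauss N) / (\<integral>g. exp (\<theta> * H g) \<partial>gauss N)"

text \<open>At \<open>g = 0\<close>, where the Hamiltonian is left undefined in the mathematics, division by zero
  yields the value \<open>0\<close>; the origin is a null set for every \<open>N \<ge> 1\<close>.  The same applies to the
  decoupled Hamiltonian when all coordinates except the \<open>d\<close>-th vanish and \<open>N \<ge> 2\<close>.\<close>

definition hamiltonian :: "(nat \<Rightarrow> nat \<Rightarrow> real) \<Rightarrow> nat \<Rightarrow> (nat \<Rightarrow> real) \<Rightarrow> real" where
  "hamiltonian \<gamma> N g =
     real N * (\<Sum>i\<in>{1..N}. \<gamma> N i * (g i)\<^sup>2 / (L2_set g {1..N})\<^sup>2)"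

definition h_density :: "(nat \<Rightarrow> nat \<Rightarrow> real) \<Rightarrow> nat \<Rightarrow> (nat \<Rightarrow> real) \<Rightarrow> real" where
  "h_density \<gamma> N g = hamiltonian \<gamma> N g / real N"

text \<open>The parameter \<open>b\<close> below is the upper bound \<open>\<gamma>\<close>-tilde of the eigenvalues.\<close>

definition S_tr :: "real measure \<Rightarrow> real \<Rightarrow> real" where
  "S_tr \<rho> z = (\<integral>x. 1 / (z - x) \<partial>\<rho>)"

definition S_max :: "real \<Rightarrow> real measure \<Rightarrow> ereal" where
  "S_max b \<rho> = Lim (at_right b) (\<lambda>z. ereal (S_tr \<rho> z))"

definition S_min :: "real measure \<Rightarrow> ereal" where
  "S_min \<rho> = Lim (at_left 0) (\<lambda>z. ereal (S_tr \<rho> z))"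

definition K_tr :: "real \<Rightarrow> real measure \<Rightarrow> real \<Rightarrow> real" where
  "K_tr b \<rho> = the_inv_into (- {0..b}) (S_tr \<rho>)"

definition R_tr :: "real \<Rightarrow> real measure \<Rightarrow> real \<Rightarrow> real" where
  "R_tr b \<rho> x = K_tr b \<rho> x - 1 / x"

definition T_set :: "real \<Rightarrow> real measure \<Rightarrow> real set" where
  "T_set b \<rho> = {\<theta>. S_min \<rho> / 2 < ereal \<theta> \<and> ereal \<theta> < S_max b \<rho> / 2} - {0}"

definition v_lim :: "real \<Rightarrow> real measure \<Rightarrow> real \<Rightarrow> real" where
  "v_lim b \<rho> \<theta> = R_tr b \<rho> (2 * \<theta>)"

definition a_rate :: "(nat \<Rightarrow> nat \<Rightarrow> real) \<Rightarrow> real \<Rightarrow> real measure \<Rightarrow> nat \<Rightarrow> real \<Rightarrow> real" where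
  "a_rate \<gamma> b \<rho> N \<theta> =
     gibbs_mean N (hamiltonian \<gamma> N) \<theta> (\<lambda>g. (h_density \<gamma> N g - v_lim b \<rho> \<theta>)\<^sup>2)"

definition a_tilde :: "(nat \<Rightarrow> nat \<Rightarrow> real) \<Rightarrow> real \<Rightarrow> real measure \<Rightarrow> nat \<Rightarrow> real \<Rightarrow> real" where
  "a_tilde \<gamma> b \<rho> N \<theta> = 1 / sqrt (real N) + sqrt (a_rate \<gamma> b \<rho> N \<theta>)"

definition decoupled_hamiltonian ::
  "(nat \<Rightarrow> nat \<Rightarrow> real) \<Rightarrow> real \<Rightarrow> real measure \<Rightarrow> nat \<Rightarrow> real \<Rightarrow> nat \<Rightarrow> (nat \<Rightarrow> real) \<Rightarrow> real" where
  "decoupled_hamiltonian \<gamma> b \<rho> N \<theta> d g =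
     real N * (\<Sum>i\<in>{1..N} - {d}. \<gamma> N i * (g i)\<^sup>2 / (L2_set g ({1..N} - {d}))\<^sup>2)
     - (v_lim b \<rho> \<theta> - \<gamma> N d) * (g d)\<^sup>2"

definition sup_norm :: "nat \<Rightarrow> ((nat \<Rightarrow> real) \<Rightarrow> real) \<Rightarrow> real" where
  "sup_norm N f = (SUP g\<in>space (RN N). \<bar>f g\<bar>)"

end

theory Submission
  imports Defs "HOL-Real_Asymp.Real_Asymp"
begin

text \<open>
  Up to normalisation it suffices to bound \<open>\<integral> \<bar>e^{\<theta> H} - e^{\<theta> H_d}\<bar> dG\<close> by \<open>Z_N\<close> times a multiple of
  \<open>N^{-1/2} + a_N^{1/2}\<close>. Write \<open>x = g_d\<close>, \<open>s = \<parallel>g\<parallel>^2 - x^2\<close>, and let \<open>k\<close> be the energy density of \<open>g\<close> without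
  its \<open>d\<close>-th coordinate. Pointwise, the difference is at most a constant times
  \<open>(\<bar>h_N - v\<bar> + \<bar>\<parallel>g\<parallel>^2 / N - 1\<bar> + x^2 / \<parallel>g\<parallel>^2) e^{\<theta> H}\<close> plus a Gaussian-integrable function of \<open>x\<close> times
  \<open>(\<bar>s / N - 1\<bar> + \<bar>k - v\<bar> 1_{s \<approx> N} + 1 / N) e^{\<theta> N k}\<close>, since \<open>1 + 2 \<theta> (v - \<gamma>_d)\<close> is bounded away from \<open>0\<close>.

  Gaussian integration by parts controls the first term: summed over all coordinates it gives the
  variance \<open>2 N\<close> of \<open>\<parallel>g\<parallel>^2\<close> under the Gibbs measure, and in the \<open>d\<close>-th coordinate alone it gives
  \<open>\<langle>x^2 / \<parallel>g\<parallel>^2\<rangle> = O(N^{-1/2} + a_N^{1/2})\<close>. The second term does not involve \<open>x\<close>; it is compared with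
  \<open>Z_N\<close> and \<open>\<langle>\<bar>h_N - v\<bar>\<rangle>\<close> by restricting the full integrals to \<open>\<bar>x\<bar> \<le> 1\<close>, where
  \<open>e^{\<theta> H} \<ge> e^{-2 \<bar>\<theta>\<bar> b} e^{\<theta> N k}\<close> as soon as \<open>s \<ge> N / 2\<close>.
\<close>

subsection \<open>The Cauchy transform outside the support\<close>

text \<open>Nothing says that \<open>a_rate\<close> is small, and the decoupled weight may grow in
  \<open>x\<close> while the Gibbs weight stays bounded. So no typical event is fixed in advance:
  each exceptional event (squared norm away from \<open>N\<close>, energy density away from
  \<open>v\<close>) is charged, as in Markov's inequality, to a quantity whose mean is linear in the
  desired rate. Each weight pays separately. The Gibbs weight is charged to quantities of the full
  vector, which integration by parts can handle; the decoupled weight is charged to quantities free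
  of \<open>x\<close>, so that Fubini splits off a one-dimensional integral. Together with the
  Gaussian density, the decoupled weight depends on \<open>x\<close> through
  \<open>exp (- (1 + 2 * \<theta> * (v - w)) * x^2 / 2)\<close>, with \<open>w\<close> the
  \<open>d\<close>-th eigenvalue. A lower bound \<open>c\<close> for the precision leaves a margin
  \<open>c / 2\<close> in the exponent. Comparing the exponents costs \<open>c / 8\<close> twice, a
  polynomial factor costs at least another \<open>c / 8\<close>, and
  \<open>exp ((1/2 - c/8) * x^2)\<close> is still integrable.\<close>

locale supported_law = prob_space \<rho> for \<rho> :: "real measure" +
  fixes b :: real
  assumes sets_eq: "sets \<rho> = sets borel" and supp: "measure \<rho> {0..b} = 1" and b_pos: "b > 0"
begin

text \<open>For \<open>z\<close> outside the interval, this is its distance to the interval. The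
  upper bounds on the transform depend on \<open>z\<close> only through it.\<close>

definition gap :: "real \<Rightarrow> real" where
  "gap z = (if z > b then z - b else - z)"

lemma gap_pos: "z \<notin> {0..b} \<Longrightarrow> gap z > 0"
  by (auto simp: gap_def)

lemma AE_supp: "AE x in \<rho>. x \<in> {0..b}"
proof -
  have "{0..b} \<in> sets \<rho>" by (simp add: sets_eq)
  then show ?thesis using supp by (simp add: prob_eq_1)
qed

lemma measurable_law [measurable]: "f \<in> borel_measurable borel \<Longrightarrow> f \<in> borel_measurable \<rho>"
  using measurable_cong_sets[OF sets_eq refl] by blast

lemma gap_le: "z \<notin> {0..b} \<Longrightarrow> x \<in> {0..b} \<Longrightarrow> gap z \<le> \<bar>z - x\<bar>"
  by (auto simp: gap_def)

lemma AE_cauchy_kernel_le: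
  assumes "z \<notin> {0..b}" shows "AE x in \<rho>. \<bar>1 / (z - x)\<bar> \<le> 1 / gap z"
  using AE_supp
proof eventually_elim
  case (elim x)
  then show ?case
    using gap_le[OF assms elim] gap_pos[OF assms] by (auto intro!: divide_left_mono)
qed

lemma integrable_cauchy_kernel: "z \<notin> {0..b} \<Longrightarrow> integrable \<rho> (\<lambda>x. 1 / (z - x))"
  using AE_cauchy_kernel_le by (intro integrable_const_bound[where B = "1 / gap z"]) auto

lemma S_tr_abs_le:
  assumes "z \<notin> {0..b}" shows "\<bar>S_tr \<rho> z\<bar> \<le> 1 / gap z"
proof -
  have "\<bar>S_tr \<rho> z\<bar> \<le> (\<integral>x. \<bar>1 / (z - x)\<bar> \<partial>\<rho>)"
    unfolding S_tr_def by (rule integral_abs_bound)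
  also have "\<dots> \<le> 1 / gap z"
    using AE_cauchy_kernel_le[OF assms] integrable_cauchy_kernel[OF assms]
    by (intro integral_le_const integrable_abs)
  finally show ?thesis .
qed

lemma S_tr_diff:
  assumes "z \<notin> {0..b}" "z' \<notin> {0..b}"
  shows "integrable \<rho> (\<lambda>x. (z' - z) / ((z - x) * (z' - x)))"
    and "S_tr \<rho> z - S_tr \<rho> z' = (\<integral>x. (z' - z) / ((z - x) * (z' - x)) \<partial>\<rho>)"
proof -
  have AE: "AE x in \<rho>. 1 / (z - x) - 1 / (z' - x) = (z' - z) / ((z - x) * (z' - x))"
    using AE_supp by eventually_elim (use assms in \<open>auto simp: divide_simps\<close>)
  have int: "integrable \<rho> (\<lambda>x. 1 / (z - x) - 1 / (z' - x))"
    using assms integrable_cauchy_kernel by auto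
  show "integrable \<rho> (\<lambda>x. (z' - z) / ((z - x) * (z' - x)))"
    by (rule integrable_cong_AE_imp[OF int]) (use AE in auto)
  have "S_tr \<rho> z - S_tr \<rho> z' = (\<integral>x. 1 / (z - x) - 1 / (z' - x) \<partial>\<rho>)"
    unfolding S_tr_def using assms integrable_cauchy_kernel by simp
  also have "\<dots> = (\<integral>x. (z' - z) / ((z - x) * (z' - x)) \<partial>\<rho>)"
    by (rule integral_cong_AE) (use AE in auto)
  finally show "S_tr \<rho> z - S_tr \<rho> z' = (\<integral>x. (z' - z) / ((z - x) * (z' - x)) \<partial>\<rho>)" .
qed

text \<open>The difference of two kernels is \<open>z' - z\<close> times their product. Continuity
  is needed for the intermediate value theorem that inverts the transform.\<close>

lemma S_tr_lipschitz:
  assumes "z \<notin> {0..b}" "z' \<notin> {0..b}" "0 < m" "m \<le> gap z" "m \<le> gap z'"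
  shows "\<bar>S_tr \<rho> z - S_tr \<rho> z'\<bar> \<le> \<bar>z - z'\<bar> / m\<^sup>2"
proof -
  have AE: "AE x in \<rho>. \<bar>(z' - z) / ((z - x) * (z' - x))\<bar> \<le> \<bar>z - z'\<bar> / m\<^sup>2"
    using AE_supp
  proof eventually_elim
    case (elim x)
    have "m * m \<le> \<bar>z - x\<bar> * \<bar>z' - x\<bar>"
      using gap_le[OF assms(1) elim] gap_le[OF assms(2) elim] assms by (intro mult_mono) auto
    moreover have "0 < m * m" using assms(3) by simp
    ultimately show ?case
      by (auto simp: abs_mult power2_eq_square abs_minus_commute intro!: divide_left_mono)
  qed
  have "\<bar>S_tr \<rho> z - S_tr \<rho> z'\<bar> \<le> (\<integral>x. \<bar>(z' - z) / ((z - x) * (z' - x))\<bar> \<partial>\<rho>)"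
    unfolding S_tr_diff(2)[OF assms(1,2)] by (rule integral_abs_bound)
  also have "\<dots> \<le> \<bar>z - z'\<bar> / m\<^sup>2"
    using AE S_tr_diff(1)[OF assms(1,2)] by (intro integral_le_const integrable_abs)
  finally show ?thesis .
qed

text \<open>The kernel difference is bounded below by a positive constant, uniformly on the support,
  so strictness survives the integration.\<close>

lemma S_tr_strict:
  assumes "z < z'" "z > b \<or> z' < 0"
  shows "S_tr \<rho> z' < S_tr \<rho> z"
proof -
  have nz: "z \<notin> {0..b}" "z' \<notin> {0..b}" using assms b_pos by auto
  let ?c = "(z' - z) / ((\<bar>z\<bar> + b) * (\<bar>z'\<bar> + b))"
  have AE: "AE x in \<rho>. ?c \<le> (z' - z) / ((z - x) * (z' - x))"
    using AE_supp
  proof eventually_elim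
    case (elim x)
    have pos: "(z - x) * (z' - x) > 0"
      using assms elim by (intro iffD2[OF zero_less_mult_iff]) auto
    then have "(z - x) * (z' - x) = \<bar>z - x\<bar> * \<bar>z' - x\<bar>"
      by (metis abs_mult abs_of_pos)
    also have "\<bar>z - x\<bar> * \<bar>z' - x\<bar> \<le> (\<bar>z\<bar> + b) * (\<bar>z'\<bar> + b)"
      using elim b_pos by (intro mult_mono) auto
    finally show ?case
      using assms(1) pos by (intro divide_left_mono mult_pos_pos[of _ "(z - x) * (z' - x)"]) auto
  qed
  have "0 < ?c" using assms b_pos by (intro divide_pos_pos mult_pos_pos) auto
  also have "?c \<le> (\<integral>x. (z' - z) / ((z - x) * (z' - x)) \<partial>\<rho>)"
    using AE S_tr_diff(1)[OF nz] by (intro integral_ge_const)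
  also have "\<dots> = S_tr \<rho> z - S_tr \<rho> z'" using S_tr_diff(2)[OF nz] by simp
  finally show ?thesis by simp
qed

text \<open>The weak inequality is read off at a point one unit to the side, \<open>z + 1\<close> or
  \<open>z - 1\<close>; strict monotonicity then makes it strict at \<open>z\<close>.\<close>

lemma S_tr_sign:
  shows "z > b \<Longrightarrow> S_tr \<rho> z > 0" and "z < 0 \<Longrightarrow> S_tr \<rho> z < 0"
proof -
  assume z: "z > b"
  have "S_tr \<rho> (z + 1) \<ge> 0"
    unfolding S_tr_def
    by (intro integral_nonneg_AE eventually_mono[OF AE_supp]) (use z in auto)
  then show "S_tr \<rho> z > 0" using S_tr_strict[of z "z + 1"] z by simp
next
  assume z: "z < 0"
  have "0 \<le> (\<integral>x. - (1 / ((z - 1) - x)) \<partial>\<rho>)"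
    by (intro integral_nonneg_AE eventually_mono[OF AE_supp]) (use z in \<open>auto simp: divide_simps\<close>)
  then have "S_tr \<rho> (z - 1) \<le> 0" unfolding S_tr_def by simp
  then show "S_tr \<rho> z < 0" using S_tr_strict[of "z - 1" z] z by simp
qed

text \<open>Strict decrease separates two points on the same side of the interval; the sign
  separates points on different sides.\<close>

lemma inj_S_tr: "inj_on (S_tr \<rho>) (- {0..b})"
proof (rule linorder_inj_onI)
  fix z z' assume "z < z'" "z \<in> - {0..b}" "z' \<in> - {0..b}"
  then show "S_tr \<rho> z \<noteq> S_tr \<rho> z'"
    using S_tr_strict[of z z'] S_tr_sign(2)[of z] S_tr_sign(1)[of z'] by force
qed auto

lemma continuous_on_S_tr:
  assumes "p > b \<or> q < 0" shows "continuous_on {p..q} (S_tr \<rho>)"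
proof -
  define m where "m = (if p > b then p - b else - q)"
  have m: "m > 0" using assms b_pos by (auto simp: m_def)
  have "(1 / m\<^sup>2)-lipschitz_on {p..q} (S_tr \<rho>)"
  proof (rule lipschitz_onI)
    fix x y assume "x \<in> {p..q}" "y \<in> {p..q}"
    then show "dist (S_tr \<rho> x) (S_tr \<rho> y) \<le> 1 / m\<^sup>2 * dist x y"
      using S_tr_lipschitz[of x y m] m assms b_pos
      by (force simp: dist_real_def m_def gap_def split: if_splits)
  qed simp
  then show ?thesis by (rule lipschitz_on_continuous_on)
qed

text \<open>\<open>Lim\<close> is informative only once convergence is known. By monotonicity the
  one-sided limit exists and is the supremum over \<open>z > b\<close>, so every number below it is
  exceeded somewhere.\<close>

lemma S_max_gt:
  assumes "ereal x < S_max b \<rho>" obtains z where "z > b" "x < S_tr \<rho> z"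
proof -
  let ?L = "SUP z\<in>{b<..}. ereal (S_tr \<rho> z)"
  have "((\<lambda>z. ereal (S_tr \<rho> z)) \<longlongrightarrow> ?L) (at_right b)"
  proof (rule increasing_tendsto)
    show "\<forall>\<^sub>F z in at_right b. ereal (S_tr \<rho> z) \<le> ?L"
      using eventually_at_right_less[of b] by eventually_elim (auto intro!: SUP_upper)
    fix y assume "y < ?L"
    then obtain z0 where z0: "z0 > b" "y < ereal (S_tr \<rho> z0)" by (auto simp: less_SUP_iff)
    show "\<forall>\<^sub>F z in at_right b. y < ereal (S_tr \<rho> z)"
      using eventually_at_right_real[OF z0(1)]
    proof eventually_elim
      case (elim z)
      then have "S_tr \<rho> z0 < S_tr \<rho> z" by (intro S_tr_strict) auto
      then show ?case using z0(2) less_ereal.simps(1) less_trans by blast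
    qed
  qed
  then have "S_max b \<rho> = ?L" unfolding S_max_def by (intro tendsto_Lim) auto
  with assms show thesis using that by (auto simp: less_SUP_iff)
qed

lemma S_min_lt:
  assumes "S_min \<rho> < ereal x" obtains z where "z < 0" "S_tr \<rho> z < x"
proof -
  let ?L = "INF z\<in>{..<0}. ereal (S_tr \<rho> z)"
  have "((\<lambda>z. ereal (S_tr \<rho> z)) \<longlongrightarrow> ?L) (at_left 0)"
  proof (rule decreasing_tendsto)
    show "\<forall>\<^sub>F z in at_left 0. ?L \<le> ereal (S_tr \<rho> z)"
      by (rule eventually_at_leftI[of "-1"]) (auto intro!: INF_lower)
    fix y assume "?L < y"
    then obtain z0 where z0: "z0 < 0" "ereal (S_tr \<rho> z0) < y" by (auto simp: INF_less_iff)
    show "\<forall>\<^sub>F z in at_left 0. ereal (S_tr \<rho> z) < y"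
      using eventually_at_left_real[OF z0(1)]
    proof eventually_elim
      case (elim z)
      then have "S_tr \<rho> z < S_tr \<rho> z0" by (intro S_tr_strict) auto
      then show ?case using z0(2) less_ereal.simps(1) less_trans by blast
    qed
  qed
  then have "S_min \<rho> = ?L" unfolding S_min_def by (intro tendsto_Lim) auto
  with assms show thesis using that by (auto simp: INF_less_iff)
qed

lemma K_tr_eqI:
  assumes "z \<notin> {0..b}" "S_tr \<rho> z = x" shows "K_tr b \<rho> x = z"
  unfolding K_tr_def using assms by (intro the_inv_into_f_eq[OF inj_S_tr]) auto

lemma K_tr_pos:
  assumes "0 < x" "ereal x < S_max b \<rho>" shows "K_tr b \<rho> x > b"
proof -
  obtain p where p: "p > b" "x < S_tr \<rho> p" using S_max_gt[OF assms(2)] by blast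
  \<comment> \<open>From distance \<open>1 / x\<close> on, the bound by \<open>1 / gap\<close> puts
    the transform at or below \<open>x\<close>, so \<open>p\<close> and \<open>q\<close> bracket the
    value \<open>x\<close>.\<close>
  define q where "q = max p (b + 1 / x)"
  have q: "q > b" "q \<ge> p" "gap q \<ge> 1 / x" using p b_pos assms(1) by (auto simp: q_def gap_def max_def)
  have "S_tr \<rho> q \<le> 1 / gap q" using S_tr_abs_le[of q] q b_pos by auto
  also have "\<dots> \<le> x" using q(3) assms(1) gap_pos[of q] q b_pos by (auto simp: field_simps)
  finally have "\<exists>z\<ge>p. z \<le> q \<and> S_tr \<rho> z = x"
    using p q by (intro IVT2' continuous_on_S_tr) auto
  then show ?thesis using K_tr_eqI p by fastforce
qed

lemma K_tr_neg:
  assumes "x < 0" "S_min \<rho> < ereal x" shows "K_tr b \<rho> x < 0"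
proof -
  obtain q where q: "q < 0" "S_tr \<rho> q < x" using S_min_lt[OF assms(2)] by blast
  define p where "p = min q (1 / x)"
  have p: "p < 0" "p \<le> q" "gap p \<ge> - 1 / x"
    using q b_pos assms(1) by (auto simp: p_def gap_def min_def)
  have "- S_tr \<rho> p \<le> 1 / gap p" using S_tr_abs_le[of p] p b_pos by auto
  also have "\<dots> \<le> - x" using p(3) assms(1) gap_pos[of p] p b_pos by (auto simp: field_simps)
  finally have "\<exists>z\<ge>p. z \<le> q \<and> S_tr \<rho> z = x"
    using p q by (intro IVT2' continuous_on_S_tr) auto
  then show ?thesis using K_tr_eqI q by fastforce
qed

text \<open>The number \<open>1 + 2 * \<theta> * (v - w)\<close> is the inverse variance of the decoupled coordinate; it
  equals \<open>2 * \<theta> * (K - w)\<close>, where \<open>K = K_tr b \<rho> (2 * \<theta>)\<close> lies outside \<open>{0..b}\<close> on the side given by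
  the sign of \<open>\<theta>\<close>.\<close>

lemma precision_bounded_below:
  assumes "\<theta> \<in> T_set b \<rho>"
  obtains c where "c > 0" "\<And>w. w \<in> {0..b} \<Longrightarrow> c \<le> 1 + 2 * \<theta> * (v_lim b \<rho> \<theta> - w)"
proof -
  define k where "k = K_tr b \<rho> (2 * \<theta>)"
  have \<theta>: "S_min \<rho> / 2 < ereal \<theta>" "ereal \<theta> < S_max b \<rho> / 2" "\<theta> \<noteq> 0"
    using assms by (auto simp: T_set_def)
  have lim: "S_min \<rho> < ereal (2 * \<theta>)" "ereal (2 * \<theta>) < S_max b \<rho>"
    using \<theta>(1,2) by (cases "S_min \<rho>"; simp; fail) (use \<theta>(1,2) in \<open>cases "S_max b \<rho>"; simp\<close>)
  have eq: "1 + 2 * \<theta> * (v_lim b \<rho> \<theta> - w) = 2 * \<theta> * (k - w)" for w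
    using \<theta>(3) by (simp add: v_lim_def R_tr_def k_def field_simps)
  show thesis
  proof (cases "\<theta> > 0")
    case True
    then have "k > b" using K_tr_pos lim unfolding k_def by simp
    \<comment> \<open>The precision is affine in \<open>w\<close> and smallest at the endpoint
      nearest to \<open>k\<close>: \<open>w = b\<close> here, \<open>w = 0\<close> for negative
      \<open>\<theta>\<close>.\<close>
    with True show thesis
      by (intro that[of "2 * \<theta> * (k - b)"]) (auto simp: eq)
  next
    case False
    then have "k < 0" using K_tr_neg lim \<theta>(3) unfolding k_def by simp
    with False \<theta>(3) show thesis
      by (intro that[of "2 * \<theta> * k"]) (auto simp: eq mult_pos_neg mult_neg_neg)
  qed
qed

end

subsection \<open>Gaussian integration by parts\<close>

lemma integrable_std_normal_iff:
  fixes f :: "real \<Rightarrow> real"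
  assumes "f \<in> borel_measurable borel"
  shows "integrable std_normal_distribution f \<longleftrightarrow> integrable lborel (\<lambda>x. std_normal_density x * f x)"
  using assms by (subst integrable_density) auto

lemma integral_std_normal:
  fixes f :: "real \<Rightarrow> real"
  assumes "f \<in> borel_measurable borel"
  shows "(\<integral>x. f x \<partial>std_normal_distribution) = (\<integral>x. std_normal_density x * f x \<partial>lborel)"
  using assms by (subst integral_density) auto

lemma integrable_std_normal_power: "integrable std_normal_distribution (\<lambda>x. x ^ k)"
  using integrable_std_normal_moment[of k] by (subst integrable_std_normal_iff) auto

lemma DERIV_std_normal_density:
  "(std_normal_density has_real_derivative - x * std_normal_density x) (at x)"
  unfolding std_normal_density_def
  by (auto intro!: derivative_eq_intros simp: field_simps)

lemma std_normal_density_poly_tendsto_0: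
  "((\<lambda>x. x * (1 + x\<^sup>2) * std_normal_density x) \<longlongrightarrow> 0) at_top"
  "((\<lambda>x. x * (1 + x\<^sup>2) * std_normal_density x) \<longlongrightarrow> 0) at_bot"
  unfolding std_normal_density_def by real_asymp+

text \<open>This is the Gaussian identity E[x f(x)] = E[f'(x)] for \<open>f x = x * F x\<close>. The
  factor \<open>x\<^sup>2 - 1\<close> is the useful form because its sum over coordinates is the
  squared norm minus the dimension. Quadratic growth gives integrability of both sides and kills the
  boundary terms.\<close>

lemma stein_std_normal:
  fixes F F' :: "real \<Rightarrow> real"
  assumes der: "\<And>x. (F has_real_derivative F' x) (at x)"
    and cont: "continuous_on UNIV F'"
    and F_le: "\<And>x. \<bar>F x\<bar> \<le> C * (1 + x\<^sup>2)"
    and F'_le: "\<And>x. \<bar>x * F' x\<bar> \<le> C * (1 + x\<^sup>2)"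
  shows "(\<integral>x. (x\<^sup>2 - 1) * F x \<partial>std_normal_distribution) = (\<integral>x. x * F' x \<partial>std_normal_distribution)"
proof -
  have contF: "continuous_on UNIV F"
    using der by (meson DERIV_isCont continuous_at_imp_continuous_on)
  have [measurable]: "F \<in> borel_measurable borel" "F' \<in> borel_measurable borel"
    using contF cont by (auto intro: borel_measurable_continuous_onI)
  have int1: "integrable std_normal_distribution (\<lambda>x. (x\<^sup>2 - 1) * F x)"
  proof (rule Bochner_Integration.integrable_bound)
    show "integrable std_normal_distribution (\<lambda>x. C * (1 + 2 * x ^ 2 + x ^ 4))"
      using integrable_std_normal_power[of 2] integrable_std_normal_power[of 4]
        integrable_std_normal_power[of 0] by simp
    have "\<bar>(x\<^sup>2 - 1) * F x\<bar> \<le> (x\<^sup>2 + 1) * (C * (1 + x\<^sup>2))" for x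
      unfolding abs_mult
    proof (intro mult_mono)
      show "\<bar>x\<^sup>2 - 1\<bar> \<le> x\<^sup>2 + 1"
        using zero_le_power2[of x] by linarith
    qed (use F_le in auto)
    moreover have "(x\<^sup>2 + 1) * (C * (1 + x\<^sup>2)) = C * (1 + 2 * x ^ 2 + x ^ 4)" for x
      by algebra
    ultimately have "\<bar>(x\<^sup>2 - 1) * F x\<bar> \<le> C * (1 + 2 * x ^ 2 + x ^ 4)" for x by simp
    then show "AE x in std_normal_distribution. norm ((x\<^sup>2 - 1) * F x) \<le> norm (C * (1 + 2 * x ^ 2 + x ^ 4))"
      unfolding real_norm_def by (intro AE_I2 order_trans[OF _ abs_ge_self])
  qed simp
  have int2: "integrable std_normal_distribution (\<lambda>x. x * F' x)"
  proof (rule Bochner_Integration.integrable_bound)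
    show "integrable std_normal_distribution (\<lambda>x. C * (1 + x ^ 2))"
      using integrable_std_normal_power[of 2] integrable_std_normal_power[of 0] by simp
    show "AE x in std_normal_distribution. norm (x * F' x) \<le> norm (C * (1 + x ^ 2))"
      unfolding real_norm_def using F'_le by (intro AE_I2 order_trans[OF _ abs_ge_self])
  qed simp
  \<comment> \<open>\<open>?g\<close> is the derivative of \<open>?G\<close>, and \<open>?G\<close>
    vanishes at both ends, so the integral of \<open>?g\<close> over the line is zero.\<close>
  let ?G = "\<lambda>x. x * F x * std_normal_density x"
  let ?g = "\<lambda>x. std_normal_density x * (F x + x * F' x - x\<^sup>2 * F x)"
  have lim0: "(?G \<longlongrightarrow> 0) net" if "((\<lambda>x. x * (1 + x\<^sup>2) * std_normal_density x) \<longlongrightarrow> 0) net" for net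
  proof (rule Lim_null_comparison)
    show "((\<lambda>x. \<bar>C\<bar> * \<bar>x * (1 + x\<^sup>2) * std_normal_density x\<bar>) \<longlongrightarrow> 0) net"
      using that by (intro tendsto_mult_right_zero tendsto_rabs_zero)
    show "\<forall>\<^sub>F x in net. norm (?G x) \<le> \<bar>C\<bar> * \<bar>x * (1 + x\<^sup>2) * std_normal_density x\<bar>"
    proof (rule always_eventually, rule allI)
      fix x :: real
      have "\<bar>F x\<bar> \<le> \<bar>C\<bar> * (1 + x\<^sup>2)"
        using F_le[of x] by (smt (verit) mult_right_mono zero_le_power2)
      then have "\<bar>x\<bar> * std_normal_density x * \<bar>F x\<bar> \<le> \<bar>x\<bar> * std_normal_density x * (\<bar>C\<bar> * (1 + x\<^sup>2))"
        by (intro mult_left_mono) auto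
      then show "norm (?G x) \<le> \<bar>C\<bar> * \<bar>x * (1 + x\<^sup>2) * std_normal_density x\<bar>"
        by (simp add: abs_mult mult_ac)
    qed
  qed
  have int: "integrable lborel ?g"
    using Bochner_Integration.integrable_diff[OF int2 int1]
    by (subst (asm) integrable_std_normal_iff) (auto simp: algebra_simps)
  have "(LBINT x=-\<infinity>..\<infinity>. ?g x) = 0 - 0"
  proof (rule interval_integral_FTC_integrable[where F = ?G])
    fix x :: real
    show "(?G has_vector_derivative ?g x) (at x)"
      unfolding has_real_derivative_iff_has_vector_derivative[symmetric]
      by (auto intro!: derivative_eq_intros der DERIV_std_normal_density simp: algebra_simps power2_eq_square)
    have "isCont F x" "isCont F' x" using contF cont by (auto simp: continuous_on_eq_continuous_at)
    then show "isCont ?g x"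
      unfolding std_normal_density_def by (intro continuous_intros) auto
  next
    show "set_integrable lborel (einterval (-\<infinity>) \<infinity>) ?g"
      using int by (simp add: set_integrable_def)
  next
    show "((?G \<circ> real_of_ereal) \<longlongrightarrow> 0) (at_right (-\<infinity>))"
      using lim0[OF std_normal_density_poly_tendsto_0(2)] by (simp add: ereal_tendsto_simps)
    show "((?G \<circ> real_of_ereal) \<longlongrightarrow> 0) (at_left \<infinity>)"
      using lim0[OF std_normal_density_poly_tendsto_0(1)] by (simp add: ereal_tendsto_simps)
  qed auto
  then have "(\<integral>x. ?g x \<partial>lborel) = 0"
    by (simp add: interval_lebesgue_integral_def set_lebesgue_integral_def)
  then have "(\<integral>x. x * F' x - (x\<^sup>2 - 1) * F x \<partial>std_normal_distribution) = 0"
    by (subst integral_std_normal) (auto simp: algebra_simps)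
  then show ?thesis using int1 int2 by simp
qed

section \<open>Product Gaussian measures, squared norms and Rayleigh quotients\<close>

abbreviation gaussian :: "'i set \<Rightarrow> ('i \<Rightarrow> real) measure" where
  "gaussian I \<equiv> Pi\<^sub>M I (\<lambda>_. std_normal_distribution)"

definition sqn :: "'i set \<Rightarrow> ('i \<Rightarrow> real) \<Rightarrow> real" where
  "sqn I g = (\<Sum>i\<in>I. (g i)\<^sup>2)"

text \<open>The index set is a parameter because the quotients with and without the
  \<open>d\<close>-th coordinate occur side by side. Where \<open>sqn\<close> vanishes the value is
  0, which lies in \<open>{0..b}\<close> as well, so the bounds below hold at every point.\<close>

definition rayleigh :: "('i \<Rightarrow> real) \<Rightarrow> 'i set \<Rightarrow> ('i \<Rightarrow> real) \<Rightarrow> real" where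
  "rayleigh w I g = (\<Sum>i\<in>I. w i * (g i)\<^sup>2) / sqn I g"

lemma prob_space_std_normal: "prob_space std_normal_distribution"
  by (rule prob_space_normal_density) simp

interpretation std_normal: prob_space std_normal_distribution
  by (rule prob_space_std_normal)

interpretation gaussian: product_sigma_finite "\<lambda>_::'i. std_normal_distribution"
  by (rule product_sigma_finite.intro) unfold_locales

lemma prob_space_gaussian: "prob_space (gaussian I)"
  by (intro prob_space_PiM prob_space_std_normal)

lemma sets_gaussian: "sets (gaussian I) = sets (Pi\<^sub>M I (\<lambda>_. borel))"
  by (intro sets_PiM_cong) auto

lemma measurable_gaussian_coord:
  "i \<in> I \<Longrightarrow> (\<lambda>g. g i) \<in> borel_measurable (gaussian I)"
  using measurable_component_singleton[of i I "\<lambda>_. std_normal_distribution"]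
  by (simp cong: measurable_cong_sets)

lemma measurable_sqn: "J \<subseteq> I \<Longrightarrow> sqn J \<in> borel_measurable (gaussian I)"
  unfolding sqn_def[abs_def] by (intro borel_measurable_sum) (auto intro!: borel_measurable_power measurable_gaussian_coord)

lemma measurable_rayleigh: "J \<subseteq> I \<Longrightarrow> rayleigh w J \<in> borel_measurable (gaussian I)"
  unfolding rayleigh_def[abs_def]
  by (intro borel_measurable_divide borel_measurable_sum measurable_sqn)
     (auto intro!: borel_measurable_power borel_measurable_times measurable_gaussian_coord)

lemma sqn_nonneg: "0 \<le> sqn I g"
  by (simp add: sqn_def sum_nonneg)

lemma sqn_ge_coord: "finite I \<Longrightarrow> i \<in> I \<Longrightarrow> (g i)\<^sup>2 \<le> sqn I g"
  unfolding sqn_def by (intro member_le_sum) auto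

lemma coord_ratio_bounds:
  assumes "finite I" "i \<in> I" shows "0 \<le> (g i)\<^sup>2 / sqn I g" "(g i)\<^sup>2 / sqn I g \<le> 1"
  using sqn_ge_coord[OF assms, of g] sqn_nonneg[of I g] by (auto simp: divide_le_eq_1)

lemma rayleigh_bounds:
  assumes "\<forall>i\<in>I. w i \<in> {0..b}" "0 \<le> b"
  shows "0 \<le> rayleigh w I g" "rayleigh w I g \<le> b"
proof -
  show "0 \<le> rayleigh w I g"
    unfolding rayleigh_def using assms by (intro divide_nonneg_nonneg sum_nonneg sqn_nonneg) auto
  have "(\<Sum>i\<in>I. w i * (g i)\<^sup>2) \<le> b * sqn I g"
    unfolding sqn_def sum_distrib_left using assms by (intro sum_mono mult_right_mono) auto
  then show "rayleigh w I g \<le> b"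
    unfolding rayleigh_def using sqn_nonneg[of I g] assms(2)
    by (cases "sqn I g = 0") (auto simp: divide_le_eq)
qed

lemma exp_rayleigh_le:
  assumes "\<forall>i\<in>I. w i \<in> {0..b}" "0 \<le> b"
  shows "exp (\<kappa> * rayleigh w I g) \<le> exp (\<bar>\<kappa>\<bar> * b)"
proof -
  have "\<kappa> * rayleigh w I g \<le> \<bar>\<kappa>\<bar> * rayleigh w I g"
    using rayleigh_bounds[OF assms] by (intro mult_right_mono) auto
  also have "\<dots> \<le> \<bar>\<kappa>\<bar> * b" using rayleigh_bounds[OF assms] by (intro mult_left_mono) auto
  finally show ?thesis by simp
qed

lemma sqn_insert: "finite J \<Longrightarrow> i \<notin> J \<Longrightarrow> sqn (insert i J) g = sqn J g + (g i)\<^sup>2"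
  by (simp add: sqn_def)

lemma sqn_fun_upd: "i \<notin> J \<Longrightarrow> sqn J (g(i := x)) = sqn J g"
  unfolding sqn_def by (intro sum.cong) auto

lemma rayleigh_fun_upd: "i \<notin> J \<Longrightarrow> rayleigh w J (g(i := x)) = rayleigh w J g"
  unfolding rayleigh_def by (auto simp: sqn_fun_upd intro!: arg_cong2[where f = "(/)"] sum.cong)

text \<open>True also where \<open>sqn I g\<close> is 0, since then every coordinate in
  \<open>I\<close> vanishes.\<close>

lemma rayleigh_numerator:
  "finite I \<Longrightarrow> (\<Sum>i\<in>I. w i * (g i)\<^sup>2) = rayleigh w I g * sqn I g"
  unfolding rayleigh_def by (auto simp: sqn_def sum_nonneg_eq_0_iff)

text \<open>The quotient is a weighted average of the reduced quotient and \<open>w i\<close>, which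
  exposes its dependence on the single variable \<open>g i\<close> to one-dimensional
  calculus.\<close>

lemma rayleigh_insert:
  assumes "finite J" "i \<notin> J"
  shows "rayleigh w (insert i J) g
    = (rayleigh w J g * sqn J g + w i * (g i)\<^sup>2) / (sqn J g + (g i)\<^sup>2)"
  using assms rayleigh_numerator[of J w g] by (simp add: rayleigh_def sqn_insert add_ac)

lemma AE_sqn_pos:
  assumes "finite J" "J \<noteq> {}" "J \<subseteq> I" shows "AE g in gaussian I. sqn J g > 0"
proof -
  obtain i where i: "i \<in> J" "i \<in> I" using assms by auto
  have "AE x in std_normal_distribution. x \<noteq> 0"
    by (subst AE_density) (use AE_lborel_singleton[of "0::real"] in \<open>auto elim: eventually_mono\<close>)
  then have "AE g in gaussian I. g i \<noteq> 0"
    using AE_PiM_component[of I "\<lambda>_. std_normal_distribution" i "\<lambda>x. x \<noteq> 0"] i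
      prob_space_std_normal by auto
  then show ?thesis
  proof eventually_elim
    case (elim g)
    then have "0 < (g i)\<^sup>2" by simp
    also have "\<dots> \<le> sqn J g" using assms(1) i(1) by (rule sqn_ge_coord)
    finally show ?case .
  qed
qed

lemma integrable_gaussian_coord:
  assumes "i \<in> I" shows "integrable (gaussian I) (\<lambda>g. (g i) ^ k)"
proof -
  have "integrable (distr (gaussian I) std_normal_distribution (\<lambda>g. g i)) (\<lambda>x. x ^ k)"
    using distr_PiM_component[of I "\<lambda>_. std_normal_distribution" i] assms prob_space_std_normal
      integrable_std_normal_power[of k] by simp
  then show ?thesis
    using assms integrable_distr_eq[of "\<lambda>g. g i" "gaussian I" std_normal_distribution "\<lambda>x. x ^ k"]
    by simp
qed

text \<open>By Cauchy-Schwarz the square of \<open>sqn\<close> is dominated by a finite sum of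
  fourth powers of coordinates. The exponent 2 is what the variance of \<open>sqn\<close> calls
  for.\<close>

lemma integrable_gaussian_bound:
  fixes f :: "('i \<Rightarrow> real) \<Rightarrow> real"
  assumes fin: "finite I" and f: "f \<in> borel_measurable (gaussian I)"
    and le: "\<And>g. \<bar>f g\<bar> \<le> C * (1 + sqn I g)\<^sup>2"
  shows "integrable (gaussian I) f"
proof (rule Bochner_Integration.integrable_bound[OF _ f])
  interpret prob_space "gaussian I" by (rule prob_space_gaussian)
  let ?D = "\<lambda>g::'i \<Rightarrow> real. \<bar>C\<bar> * (2 + 2 * ((\<Sum>i\<in>I. (g i) ^ 4) * card I))"
  show "integrable (gaussian I) ?D"
    by (intro integrable_mult_right Bochner_Integration.integrable_add integrable_mult_left
        Bochner_Integration.integrable_sum integrable_gaussian_coord integrable_const)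
  show "AE g in gaussian I. norm (f g) \<le> norm (?D g)"
  proof (rule AE_I2)
    fix g :: "'i \<Rightarrow> real"
    have "(sqn I g)\<^sup>2 \<le> (\<Sum>i\<in>I. ((g i)\<^sup>2)\<^sup>2) * card I"
      unfolding sqn_def by (rule sum_squared_le_sum_of_squares)
    then have sq: "(sqn I g)\<^sup>2 \<le> (\<Sum>i\<in>I. (g i) ^ 4) * card I"
      unfolding power_mult[symmetric] by simp
    have "(1 + sqn I g)\<^sup>2 \<le> 2 + 2 * (sqn I g)\<^sup>2"
      using zero_le_power2[of "1 - sqn I g"] by (simp add: power2_eq_square algebra_simps)
    also have "\<dots> \<le> 2 + 2 * ((\<Sum>i\<in>I. (g i) ^ 4) * card I)" using sq by simp
    finally have *: "(1 + sqn I g)\<^sup>2 \<le> 2 + 2 * ((\<Sum>i\<in>I. (g i) ^ 4) * card I)" .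
    have "\<bar>f g\<bar> \<le> \<bar>C\<bar> * (1 + sqn I g)\<^sup>2"
      using le[of g] mult_right_mono[OF abs_ge_self[of C], of "(1 + sqn I g)\<^sup>2"] by simp
    also have "\<dots> \<le> ?D g" using * by (intro mult_left_mono) auto
    finally show "norm (f g) \<le> norm (?D g)" by simp
  qed
qed

section \<open>Integration by parts under a Rayleigh tilt\<close>

lemma stein_rayleigh:
  fixes S A b w \<kappa> \<alpha> \<beta> :: real
  assumes S: "S > 0" and A: "0 \<le> A" "A \<le> b" and w: "0 \<le> w" "w \<le> b"
  defines "h \<equiv> \<lambda>x. (A * S + w * x\<^sup>2) / (S + x\<^sup>2)"
  shows "(\<integral>x. (x\<^sup>2 - 1) * ((\<alpha> + \<beta> * (S + x\<^sup>2)) * exp (\<kappa> * h x)) \<partial>std_normal_distribution)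
    = (\<integral>x. (2 * \<beta> * x\<^sup>2 + (\<alpha> + \<beta> * (S + x\<^sup>2)) * (2 * \<kappa>) * (x\<^sup>2 / (S + x\<^sup>2)) * (w - h x))
          * exp (\<kappa> * h x) \<partial>std_normal_distribution)"
proof -
  have pos: "S + x\<^sup>2 > 0" for x using S by (simp add: add_pos_nonneg)
  have nz: "S + x\<^sup>2 \<noteq> 0" for x using pos[of x] by simp
  let ?F = "\<lambda>x. (\<alpha> + \<beta> * (S + x\<^sup>2)) * exp (\<kappa> * h x)"
  \<comment> \<open>The derivative of \<open>h\<close> simplifies to
    \<open>2 * x * (w - h x) / (S + x\<^sup>2)\<close>: only \<open>h\<close> itself reappears, and
    multiplying by \<open>x\<close> yields the squared coordinate ratio.\<close>
  let ?F' = "\<lambda>x. (2 * \<beta> * x + (\<alpha> + \<beta> * (S + x\<^sup>2)) * (2 * \<kappa>) * (x / (S + x\<^sup>2)) * (w - h x)) * exp (\<kappa> * h x)"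
  let ?E = "exp (\<bar>\<kappa>\<bar> * b)"
  let ?P = "\<bar>\<alpha>\<bar> + \<bar>\<beta>\<bar> * (S + 1)"
  let ?C = "(2 * \<bar>\<beta>\<bar> + ?P * (1 + 2 * \<bar>\<kappa>\<bar> * b)) * ?E"
  have b: "0 \<le> b" using A by simp
  have h: "0 \<le> h x" "h x \<le> b" for x
  proof -
    have "A * S + w * x\<^sup>2 \<le> b * S + b * x\<^sup>2"
      using A w S by (intro add_mono mult_right_mono) auto
    then show "0 \<le> h x" "h x \<le> b"
      unfolding h_def using A w S pos[of x] by (auto simp: divide_le_eq algebra_simps)
  qed
  have e: "exp (\<kappa> * h x) \<le> ?E" for x
  proof -
    have "\<kappa> * h x \<le> \<bar>\<kappa>\<bar> * h x" using h[of x] by (intro mult_right_mono) auto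
    also have "\<dots> \<le> \<bar>\<kappa>\<bar> * b" using h[of x] by (intro mult_left_mono) auto
    finally show ?thesis by simp
  qed
  have P: "\<bar>\<alpha> + \<beta> * (S + x\<^sup>2)\<bar> \<le> ?P * (1 + x\<^sup>2)" for x
  proof -
    have "\<bar>\<alpha> + \<beta> * (S + x\<^sup>2)\<bar> \<le> \<bar>\<alpha>\<bar> + \<bar>\<beta>\<bar> * (S + x\<^sup>2)"
      using abs_triangle_ineq[of \<alpha> "\<beta> * (S + x\<^sup>2)"] pos[of x] by (simp add: abs_mult)
    also have "\<dots> \<le> ?P * (1 + x\<^sup>2)"
    proof -
      have "0 \<le> \<bar>\<alpha>\<bar> * x\<^sup>2 + \<bar>\<beta>\<bar> + \<bar>\<beta>\<bar> * (S * x\<^sup>2)" using S by auto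
      then show ?thesis by (simp add: algebra_simps)
    qed
    finally show ?thesis .
  qed
  have P0: "0 \<le> ?P" using S by auto
  have k0: "0 \<le> 2 * \<bar>\<kappa>\<bar> * b" using b by simp
  have x1: "0 \<le> 1 + x\<^sup>2" for x :: real by simp
  have scale: "x * ((2 * \<beta> * x + m * (2 * \<kappa>) * (x / s) * y) * e) = (2 * \<beta> * x\<^sup>2 + m * (2 * \<kappa> * (x\<^sup>2 / s) * y)) * e"
    for x m s y e :: real
    by (simp add: power2_eq_square distrib_left mult_ac)
  have x_times_F': "x * ?F' x = (2 * \<beta> * x\<^sup>2
      + (\<alpha> + \<beta> * (S + x\<^sup>2)) * (2 * \<kappa> * (x\<^sup>2 / (S + x\<^sup>2)) * (w - h x))) * exp (\<kappa> * h x)" for x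
    by (rule scale)
  have "(\<integral>x. (x\<^sup>2 - 1) * ?F x \<partial>std_normal_distribution) = (\<integral>x. x * ?F' x \<partial>std_normal_distribution)"
  proof (rule stein_std_normal[where C = ?C])
    fix x
    show "(?F has_real_derivative ?F' x) (at x)"
      unfolding h_def
      by (rule derivative_eq_intros refl nz)+ (use nz[of x] in \<open>simp add: field_simps power2_eq_square\<close>)
    have "\<bar>?F x\<bar> \<le> (?P * (1 + x\<^sup>2)) * ?E"
      unfolding abs_mult using P[of x] e[of x] P0 x1[of x] by (intro mult_mono mult_nonneg_nonneg) auto
    also have "\<dots> \<le> ?C * (1 + x\<^sup>2)"
    proof -
      have "0 \<le> (2 * \<bar>\<beta>\<bar> + ?P * (2 * \<bar>\<kappa>\<bar> * b)) * ?E * (1 + x\<^sup>2)"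
        using P0 k0 x1 S b by (intro mult_nonneg_nonneg add_nonneg_nonneg) auto
      then show ?thesis by (simp add: algebra_simps)
    qed
    finally show "\<bar>?F x\<bar> \<le> ?C * (1 + x\<^sup>2)" .
    have r: "0 \<le> x\<^sup>2 / (S + x\<^sup>2)" "x\<^sup>2 / (S + x\<^sup>2) \<le> 1" using pos[of x] S by auto
    have wh: "\<bar>w - h x\<bar> \<le> b" using w h[of x] by auto
    have "\<bar>x * ?F' x\<bar> = \<bar>(2 * \<beta> * x\<^sup>2 + (\<alpha> + \<beta> * (S + x\<^sup>2)) * (2 * \<kappa> * (x\<^sup>2 / (S + x\<^sup>2)) * (w - h x)))\<bar> * exp (\<kappa> * h x)"
      unfolding x_times_F' abs_mult[of _ "exp _"] by simp
    also have "\<dots> \<le> (2 * \<bar>\<beta>\<bar> * (1 + x\<^sup>2) + (?P * (1 + x\<^sup>2)) * (2 * \<bar>\<kappa>\<bar> * b)) * ?E"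
    proof (intro mult_mono e)
      have "\<bar>2 * \<kappa> * (x\<^sup>2 / (S + x\<^sup>2)) * (w - h x)\<bar> \<le> 2 * \<bar>\<kappa>\<bar> * 1 * b"
        unfolding abs_mult abs_of_nonneg[OF r(1)] using r wh b by (intro mult_mono) auto
      then have "\<bar>(\<alpha> + \<beta> * (S + x\<^sup>2)) * (2 * \<kappa> * (x\<^sup>2 / (S + x\<^sup>2)) * (w - h x))\<bar> \<le> (?P * (1 + x\<^sup>2)) * (2 * \<bar>\<kappa>\<bar> * b)"
        unfolding abs_mult[of "\<alpha> + \<beta> * (S + x\<^sup>2)"] using P[of x] P0 x1[of x] by (intro mult_mono mult_nonneg_nonneg) auto
      moreover have "\<bar>2 * \<beta> * x\<^sup>2\<bar> \<le> 2 * \<bar>\<beta>\<bar> * (1 + x\<^sup>2)" by (simp add: abs_mult algebra_simps)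
      ultimately show "\<bar>2 * \<beta> * x\<^sup>2 + (\<alpha> + \<beta> * (S + x\<^sup>2)) * (2 * \<kappa> * (x\<^sup>2 / (S + x\<^sup>2)) * (w - h x))\<bar>
          \<le> 2 * \<bar>\<beta>\<bar> * (1 + x\<^sup>2) + (?P * (1 + x\<^sup>2)) * (2 * \<bar>\<kappa>\<bar> * b)"
        by (rule order_trans[OF abs_triangle_ineq add_mono, rotated])
      show "0 \<le> 2 * \<bar>\<beta>\<bar> * (1 + x\<^sup>2) + (?P * (1 + x\<^sup>2)) * (2 * \<bar>\<kappa>\<bar> * b)"
        using S b by (intro add_nonneg_nonneg mult_nonneg_nonneg) auto
    qed auto
    also have "\<dots> \<le> ?C * (1 + x\<^sup>2)"
    proof -
      have "0 \<le> ?P * ?E * (1 + x\<^sup>2)" using P0 x1 by (intro mult_nonneg_nonneg) auto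
      then show ?thesis by (simp add: algebra_simps)
    qed
    finally show "\<bar>x * ?F' x\<bar> \<le> ?C * (1 + x\<^sup>2)" .
  next
    show "continuous_on UNIV ?F'"
      unfolding h_def using nz by (intro continuous_intros) auto
  qed
  also have "\<dots> = (\<integral>x. (2 * \<beta> * x\<^sup>2 + (\<alpha> + \<beta> * (S + x\<^sup>2)) * (2 * \<kappa>) * (x\<^sup>2 / (S + x\<^sup>2)) * (w - h x))
          * exp (\<kappa> * h x) \<partial>std_normal_distribution)"
    unfolding x_times_F' by (simp only: mult.assoc)
  finally show ?thesis .
qed

lemma abs_coord_minus_one_le:
  assumes "finite I" "i \<in> I" shows "\<bar>(g i)\<^sup>2 - 1\<bar> \<le> 1 + sqn I g"
  using sqn_ge_coord[OF assms, of g] zero_le_power2[of "g i"] by linarith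

lemma integrable_gaussian_tilt:
  fixes f :: "('i \<Rightarrow> real) \<Rightarrow> real"
  assumes fin: "finite I" and f: "f \<in> borel_measurable (gaussian I)"
    and w: "\<forall>i\<in>J. w i \<in> {0..b}" and b: "0 \<le> b" and J: "J \<subseteq> I"
    and le: "\<And>g. \<bar>f g\<bar> \<le> C * (1 + sqn I g)\<^sup>2"
  shows "integrable (gaussian I) (\<lambda>g. f g * exp (\<kappa> * rayleigh w J g))"
proof (rule integrable_gaussian_bound[OF fin, where C = "\<bar>C\<bar> * exp (\<bar>\<kappa>\<bar> * b)"])
  show "(\<lambda>g. f g * exp (\<kappa> * rayleigh w J g)) \<in> borel_measurable (gaussian I)"
    using f measurable_rayleigh[OF J, of w] by measurable
  fix g :: "'i \<Rightarrow> real"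
  have "\<bar>f g\<bar> \<le> \<bar>C\<bar> * (1 + sqn I g)\<^sup>2"
    using le[of g] by (smt (verit) mult_right_mono zero_le_power2)
  then have "\<bar>f g\<bar> * exp (\<kappa> * rayleigh w J g) \<le> (\<bar>C\<bar> * (1 + sqn I g)\<^sup>2) * exp (\<bar>\<kappa>\<bar> * b)"
    using exp_rayleigh_le[OF w b] by (intro mult_mono) auto
  then show "\<bar>f g * exp (\<kappa> * rayleigh w J g)\<bar> \<le> \<bar>C\<bar> * exp (\<bar>\<kappa>\<bar> * b) * (1 + sqn I g)\<^sup>2"
    by (simp add: abs_mult mult_ac)
qed

text \<open>With the other coordinates frozen this is \<open>stein_rayleigh\<close>, and Fubini
  integrates them back. The one-dimensional identity needs the other coordinates to have positive
  norm; having at least two coordinates ensures this almost everywhere. The affine prefactor lets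
  one identity serve both the first and the second radial moment.\<close>

lemma ibp_coord:
  fixes i :: 'i
  assumes fin: "finite I" and i: "i \<in> I" and card: "2 \<le> card I"
    and w: "\<forall>i\<in>I. w i \<in> {0..b}" and b: "0 \<le> b"
  shows "(\<integral>g. ((g i)\<^sup>2 - 1) * (\<alpha> + \<beta> * sqn I g) * exp (\<kappa> * rayleigh w I g) \<partial>gaussian I)
    = (\<integral>g. (2 * \<beta> * (g i)\<^sup>2 + (\<alpha> + \<beta> * sqn I g) * (2 * \<kappa>) * ((g i)\<^sup>2 / sqn I g) * (w i - rayleigh w I g))
         * exp (\<kappa> * rayleigh w I g) \<partial>gaussian I)"
    (is "?lhs = ?rhs")
    and "integrable (gaussian I) (\<lambda>g. ((g i)\<^sup>2 - 1) * (\<alpha> + \<beta> * sqn I g) * exp (\<kappa> * rayleigh w I g))"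
      (is ?int1)
    and "integrable (gaussian I) (\<lambda>g. (2 * \<beta> * (g i)\<^sup>2
        + (\<alpha> + \<beta> * sqn I g) * (2 * \<kappa>) * ((g i)\<^sup>2 / sqn I g) * (w i - rayleigh w I g))
         * exp (\<kappa> * rayleigh w I g))" (is ?int2)
proof -
  define J where "J = I - {i}"
  have J: "I = insert i J" "i \<notin> J" "finite J" using i fin by (auto simp: J_def)
  have "card J \<noteq> 0" using card J by auto
  then have "J \<noteq> {}" by auto
  have [measurable]: "(\<lambda>g. g i) \<in> borel_measurable (gaussian I)"
      "sqn I \<in> borel_measurable (gaussian I)" "rayleigh w I \<in> borel_measurable (gaussian I)"
      "sqn J \<in> borel_measurable (gaussian J)" "rayleigh w J \<in> borel_measurable (gaussian J)"
    using i by (auto intro: measurable_gaussian_coord measurable_sqn measurable_rayleigh)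
  have P: "\<bar>\<alpha> + \<beta> * sqn I g\<bar> \<le> (\<bar>\<alpha>\<bar> + \<bar>\<beta>\<bar>) * (1 + sqn I g)" for g
  proof -
    have "\<bar>\<alpha> + \<beta> * sqn I g\<bar> \<le> \<bar>\<alpha>\<bar> + \<bar>\<beta>\<bar> * sqn I g"
      using abs_triangle_ineq[of \<alpha> "\<beta> * sqn I g"] sqn_nonneg[of I g] by (simp add: abs_mult)
    also have "\<dots> \<le> (\<bar>\<alpha>\<bar> + \<bar>\<beta>\<bar>) * (1 + sqn I g)"
      using sqn_nonneg[of I g] by (simp add: algebra_simps)
    finally show ?thesis .
  qed
  have one: "1 + sqn I g \<le> (1 + sqn I g)\<^sup>2" for g
    using sqn_nonneg[of I g] by (simp add: self_le_power)
  show int1: ?int1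
  proof (rule integrable_gaussian_tilt[OF fin _ w b _, where C = "\<bar>\<alpha>\<bar> + \<bar>\<beta>\<bar>"])
    show "(\<lambda>g. ((g i)\<^sup>2 - 1) * (\<alpha> + \<beta> * sqn I g)) \<in> borel_measurable (gaussian I)"
      by measurable
    fix g
    have "\<bar>((g i)\<^sup>2 - 1) * (\<alpha> + \<beta> * sqn I g)\<bar> \<le> (1 + sqn I g) * ((\<bar>\<alpha>\<bar> + \<bar>\<beta>\<bar>) * (1 + sqn I g))"
      unfolding abs_mult using abs_coord_minus_one_le[OF fin i, of g] P[of g] sqn_nonneg[of I g]
      by (intro mult_mono) auto
    then show "\<bar>((g i)\<^sup>2 - 1) * (\<alpha> + \<beta> * sqn I g)\<bar> \<le> (\<bar>\<alpha>\<bar> + \<bar>\<beta>\<bar>) * (1 + sqn I g)\<^sup>2"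
      by (simp add: power2_eq_square mult_ac)
  qed auto
  show int2: ?int2
  proof (rule integrable_gaussian_tilt[OF fin _ w b,
        where C = "2 * \<bar>\<beta>\<bar> + (\<bar>\<alpha>\<bar> + \<bar>\<beta>\<bar>) * (2 * \<bar>\<kappa>\<bar> * b)"])
    show "(\<lambda>g. 2 * \<beta> * (g i)\<^sup>2 + (\<alpha> + \<beta> * sqn I g) * (2 * \<kappa>) * ((g i)\<^sup>2 / sqn I g) * (w i - rayleigh w I g))
        \<in> borel_measurable (gaussian I)"
      by measurable
    fix g
    let ?Q = "sqn I g"
    have wh: "\<bar>w i - rayleigh w I g\<bar> \<le> b"
      using rayleigh_bounds[OF w b, of g] w i by auto
    have r: "\<bar>(g i)\<^sup>2 / ?Q\<bar> \<le> 1" using coord_ratio_bounds[OF fin i, of g] by simp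
    have 1: "\<bar>2 * \<beta> * (g i)\<^sup>2\<bar> \<le> 2 * \<bar>\<beta>\<bar> * (1 + ?Q)\<^sup>2"
      using sqn_ge_coord[OF fin i, of g] one[of g] by (auto simp: abs_mult intro!: mult_left_mono)
    have 2: "\<bar>(\<alpha> + \<beta> * ?Q) * (2 * \<kappa>) * ((g i)\<^sup>2 / ?Q) * (w i - rayleigh w I g)\<bar>
        \<le> ((\<bar>\<alpha>\<bar> + \<bar>\<beta>\<bar>) * (1 + ?Q)) * \<bar>2 * \<kappa>\<bar> * 1 * b"
      unfolding abs_mult[of "_ * (2 * \<kappa>) * ((g i)\<^sup>2 / ?Q)"] abs_mult[of "_ * (2 * \<kappa>)"] abs_mult[of _ "2 * \<kappa>"]
      using P[of g] wh r b sqn_nonneg[of I g]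
      by (intro mult_mono mult_nonneg_nonneg abs_ge_zero) auto
    have 3: "((\<bar>\<alpha>\<bar> + \<bar>\<beta>\<bar>) * (1 + ?Q)) * \<bar>2 * \<kappa>\<bar> * 1 * b \<le> ((\<bar>\<alpha>\<bar> + \<bar>\<beta>\<bar>) * (2 * \<bar>\<kappa>\<bar> * b)) * (1 + ?Q)\<^sup>2"
      using mult_left_mono[OF one[of g], of "(\<bar>\<alpha>\<bar> + \<bar>\<beta>\<bar>) * (2 * \<bar>\<kappa>\<bar> * b)"] b by (simp add: abs_mult mult_ac)
    show "\<bar>2 * \<beta> * (g i)\<^sup>2 + (\<alpha> + \<beta> * ?Q) * (2 * \<kappa>) * ((g i)\<^sup>2 / ?Q) * (w i - rayleigh w I g)\<bar>
        \<le> (2 * \<bar>\<beta>\<bar> + (\<bar>\<alpha>\<bar> + \<bar>\<beta>\<bar>) * (2 * \<bar>\<kappa>\<bar> * b)) * (1 + ?Q)\<^sup>2"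
      unfolding distrib_right[of "2 * \<bar>\<beta>\<bar>"]
      by (rule order_trans[OF abs_triangle_ineq add_mono[OF 1 order_trans[OF 2 3]]])
  qed auto
  have "?lhs = (\<integral>g. (\<integral>x. (x\<^sup>2 - 1) * ((\<alpha> + \<beta> * (sqn J g + x\<^sup>2))
      * exp (\<kappa> * ((rayleigh w J g * sqn J g + w i * x\<^sup>2) / (sqn J g + x\<^sup>2)))) \<partial>std_normal_distribution) \<partial>gaussian J)"
    unfolding J(1)
    by (subst gaussian.product_integral_insert[OF J(3,2) int1[unfolded J(1)]])
       (simp add: J sqn_insert rayleigh_insert sqn_fun_upd rayleigh_fun_upd mult_ac)
  also have "\<dots> = (\<integral>g. (\<integral>x. (2 * \<beta> * x\<^sup>2 + (\<alpha> + \<beta> * (sqn J g + x\<^sup>2)) * (2 * \<kappa>) * (x\<^sup>2 / (sqn J g + x\<^sup>2))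
        * (w i - (rayleigh w J g * sqn J g + w i * x\<^sup>2) / (sqn J g + x\<^sup>2)))
      * exp (\<kappa> * ((rayleigh w J g * sqn J g + w i * x\<^sup>2) / (sqn J g + x\<^sup>2))) \<partial>std_normal_distribution) \<partial>gaussian J)"
  proof -
    have "AE g in gaussian J.
      (\<integral>x. (x\<^sup>2 - 1) * ((\<alpha> + \<beta> * (sqn J g + x\<^sup>2))
      * exp (\<kappa> * ((rayleigh w J g * sqn J g + w i * x\<^sup>2) / (sqn J g + x\<^sup>2)))) \<partial>std_normal_distribution)
      = (\<integral>x. (2 * \<beta> * x\<^sup>2 + (\<alpha> + \<beta> * (sqn J g + x\<^sup>2)) * (2 * \<kappa>) * (x\<^sup>2 / (sqn J g + x\<^sup>2))
        * (w i - (rayleigh w J g * sqn J g + w i * x\<^sup>2) / (sqn J g + x\<^sup>2)))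
      * exp (\<kappa> * ((rayleigh w J g * sqn J g + w i * x\<^sup>2) / (sqn J g + x\<^sup>2))) \<partial>std_normal_distribution)"
      using AE_sqn_pos[OF J(3) \<open>J \<noteq> {}\<close> subset_refl]
    proof eventually_elim
      case (elim g)
      have "\<forall>j\<in>J. w j \<in> {0..b}" using w J(1) by auto
      then show ?case
        using rayleigh_bounds[of J w b g] b w i elim by (intro stein_rayleigh) auto
    qed
    then show ?thesis by (rule integral_cong_AE[rotated 2]) measurable
  qed
  also have "\<dots> = ?rhs"
    unfolding J(1)
    by (subst gaussian.product_integral_insert[OF J(3,2) int2[unfolded J(1)]])
       (simp add: J sqn_insert rayleigh_insert sqn_fun_upd rayleigh_fun_upd)
  finally show "?lhs = ?rhs" .
qed

subsection \<open>Norm and coordinates under the Gibbs measure\<close>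

lemma exp_rayleigh_integrable:
  fixes w :: "'i \<Rightarrow> real"
  assumes fin: "finite I" and J: "J \<subseteq> I" and w: "\<forall>i\<in>J. w i \<in> {0..b}" and b: "0 \<le> b"
  shows "integrable (gaussian I) (\<lambda>g. exp (\<kappa> * rayleigh w J g))"
proof -
  have "integrable (gaussian I) (\<lambda>g. 1 * exp (\<kappa> * rayleigh w J g))"
    by (rule integrable_gaussian_tilt[OF fin _ w b J, where C = 1])
       (auto intro!: one_le_power sqn_nonneg)
  then show ?thesis by simp
qed

lemma integral_exp_rayleigh_pos:
  fixes w :: "'i \<Rightarrow> real"
  assumes fin: "finite I" and J: "J \<subseteq> I" and w: "\<forall>i\<in>J. w i \<in> {0..b}" and b: "0 \<le> b"
  shows "0 < (\<integral>g. exp (\<kappa> * rayleigh w J g) \<partial>gaussian I)"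
proof -
  interpret prob_space "gaussian I" by (rule prob_space_gaussian)
  have "exp (- \<bar>\<kappa>\<bar> * b) \<le> exp (\<kappa> * rayleigh w J g)" for g
  proof -
    have "- (\<kappa> * rayleigh w J g) \<le> \<bar>\<kappa>\<bar> * b"
      using exp_rayleigh_le[OF w b, of "- \<kappa>" g] by simp
    then show ?thesis by simp
  qed
  then have "exp (- \<bar>\<kappa>\<bar> * b) \<le> (\<integral>g. exp (\<kappa> * rayleigh w J g) \<partial>gaussian I)"
    using exp_rayleigh_integrable[OF assms] by (intro integral_ge_const) auto
  then show ?thesis by (rule less_le_trans[rotated]) simp
qed

text \<open>The Rayleigh quotient is constant along rays, so its derivatives drop out when the identities
  \<open>ibp_coord\<close> are summed over \<open>i\<close>; tilting by it leaves the moments of \<open>sqn I\<close> unchanged.\<close>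

lemma radial_moments:
  fixes w :: "'i \<Rightarrow> real"
  assumes fin: "finite I" and card: "2 \<le> card I"
    and w: "\<forall>i\<in>I. w i \<in> {0..b}" and b: "0 \<le> b"
  shows "(\<integral>g. (sqn I g - card I)\<^sup>2 * exp (\<kappa> * rayleigh w I g) \<partial>gaussian I)
    = 2 * real (card I) * (\<integral>g. exp (\<kappa> * rayleigh w I g) \<partial>gaussian I)" (is ?eq)
    and "integrable (gaussian I) (\<lambda>g. (sqn I g - card I)\<^sup>2 * exp (\<kappa> * rayleigh w I g))" (is ?int)
proof -
  let ?E = "\<lambda>g. exp (\<kappa> * rayleigh w I g)" and ?n = "real (card I)"
  note meas = measurable_sqn[of I I, OF subset_refl] measurable_rayleigh[of I I w, OF subset_refl]
  note [measurable] = meas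
  have sq: "integrable (gaussian I) (\<lambda>g. (sqn I g) ^ k * ?E g)" if "k \<le> 2" for k
  proof (rule integrable_gaussian_tilt[OF fin _ w b subset_refl, where C = 1])
    show "(\<lambda>g. sqn I g ^ k) \<in> borel_measurable (gaussian I)" by measurable
    fix g
    have "sqn I g ^ k \<le> (1 + sqn I g) ^ k" using sqn_nonneg[of I g] by (intro power_mono) auto
    also have "\<dots> \<le> (1 + sqn I g) ^ 2" using sqn_nonneg[of I g] that by (intro power_increasing) auto
    finally show "\<bar>sqn I g ^ k\<bar> \<le> 1 * (1 + sqn I g)\<^sup>2" using sqn_nonneg[of I g] by simp
  qed
  \<comment> \<open>Two instances are used: \<open>\<alpha> = 1\<close>, \<open>\<beta> = 0\<close>
    gives the mean of the squared norm, and \<open>\<alpha> = - ?n\<close>,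
    \<open>\<beta> = 1\<close> turns the left side into the second moment of
    \<open>sqn I g - ?n\<close>.\<close>
  have key: "(\<integral>g. (sqn I g - ?n) * (\<alpha> + \<beta> * sqn I g) * ?E g \<partial>gaussian I)
      = (\<integral>g. 2 * \<beta> * sqn I g * ?E g \<partial>gaussian I)" for \<alpha> \<beta>
  proof -
    have "(\<integral>g. (sqn I g - ?n) * (\<alpha> + \<beta> * sqn I g) * ?E g \<partial>gaussian I)
      = (\<integral>g. (\<Sum>i\<in>I. ((g i)\<^sup>2 - 1) * (\<alpha> + \<beta> * sqn I g) * ?E g) \<partial>gaussian I)"
      by (simp add: sum_distrib_right[symmetric] sum_subtractf sqn_def)
    also have "\<dots> = (\<Sum>i\<in>I. \<integral>g. ((g i)\<^sup>2 - 1) * (\<alpha> + \<beta> * sqn I g) * ?E g \<partial>gaussian I)"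
      using ibp_coord(2)[OF fin _ card w b] by (intro Bochner_Integration.integral_sum)
    also have "\<dots> = (\<Sum>i\<in>I. \<integral>g. (2 * \<beta> * (g i)\<^sup>2
        + (\<alpha> + \<beta> * sqn I g) * (2 * \<kappa>) * ((g i)\<^sup>2 / sqn I g) * (w i - rayleigh w I g)) * ?E g \<partial>gaussian I)"
      by (intro sum.cong refl ibp_coord(1)[OF fin _ card w b])
    also have "\<dots> = (\<integral>g. (\<Sum>i\<in>I. (2 * \<beta> * (g i)\<^sup>2
        + (\<alpha> + \<beta> * sqn I g) * (2 * \<kappa>) * ((g i)\<^sup>2 / sqn I g) * (w i - rayleigh w I g)) * ?E g) \<partial>gaussian I)"
      using ibp_coord(3)[OF fin _ card w b] by (intro Bochner_Integration.integral_sum[symmetric])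
    also have "\<dots> = (\<integral>g. 2 * \<beta> * sqn I g * ?E g \<partial>gaussian I)"
    proof (intro Bochner_Integration.integral_cong refl)
      fix g
      let ?h = "rayleigh w I g" and ?m = "(\<alpha> + \<beta> * sqn I g) * (2 * \<kappa>) / sqn I g"
      have scale: "(2 * \<beta> * q + m * (2 * \<kappa>) * (q / s) * y) * e = 2 * \<beta> * e * q + m * (2 * \<kappa>) / s * e * (q * y)"
        for q m s y e :: real
        by (simp add: distrib_right distrib_left mult_ac)
      have "(\<Sum>i\<in>I. (g i)\<^sup>2 * (w i - ?h)) = (\<Sum>i\<in>I. w i * (g i)\<^sup>2) - ?h * sqn I g"
        by (simp add: sqn_def sum_distrib_left sum_subtractf[symmetric] algebra_simps)
      also have "\<dots> = 0" using rayleigh_numerator[OF fin] by simp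
      finally have 0: "(\<Sum>i\<in>I. (g i)\<^sup>2 * (w i - ?h)) = 0" .
      have "(\<Sum>i\<in>I. (2 * \<beta> * (g i)\<^sup>2 + (\<alpha> + \<beta> * sqn I g) * (2 * \<kappa>) * ((g i)\<^sup>2 / sqn I g) * (w i - ?h)) * ?E g)
        = (\<Sum>i\<in>I. 2 * \<beta> * ?E g * (g i)\<^sup>2 + ?m * ?E g * ((g i)\<^sup>2 * (w i - ?h)))"
        by (intro sum.cong refl scale)
      also have "\<dots> = 2 * \<beta> * ?E g * sqn I g + ?m * ?E g * (\<Sum>i\<in>I. (g i)\<^sup>2 * (w i - ?h))"
        by (simp only: sum.distrib sum_distrib_left[symmetric] sqn_def)
      finally show "(\<Sum>i\<in>I. (2 * \<beta> * (g i)\<^sup>2 + (\<alpha> + \<beta> * sqn I g) * (2 * \<kappa>) * ((g i)\<^sup>2 / sqn I g) * (w i - ?h)) * ?E g)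
        = 2 * \<beta> * sqn I g * ?E g"
        by (simp add: 0)
    qed
    finally show ?thesis .
  qed
  have int: "integrable (gaussian I) ?E" "integrable (gaussian I) (\<lambda>g. sqn I g * ?E g)"
      "integrable (gaussian I) (\<lambda>g. (sqn I g)\<^sup>2 * ?E g)"
    using sq[of 0] sq[of 1] sq[of 2] by simp_all
  have expand: "(sqn I g - ?n)\<^sup>2 * ?E g = (sqn I g)\<^sup>2 * ?E g - 2 * ?n * (sqn I g * ?E g) + ?n\<^sup>2 * ?E g" for g
    by (simp add: power2_eq_square algebra_simps)
  show ?int unfolding expand using int by simp
  have "(\<integral>g. sqn I g * ?E g - ?n * ?E g \<partial>gaussian I) = 0"
    using key[of 1 0] by (simp add: algebra_simps)
  then have first: "(\<integral>g. sqn I g * ?E g \<partial>gaussian I) = ?n * (\<integral>g. ?E g \<partial>gaussian I)"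
    using int by simp
  have "(\<integral>g. (sqn I g - ?n)\<^sup>2 * ?E g \<partial>gaussian I) = 2 * (\<integral>g. sqn I g * ?E g \<partial>gaussian I)"
    using key[of "- ?n" 1] by (simp add: power2_eq_square mult.assoc)
  then show ?eq using first by simp
qed

text \<open>This is Cauchy-Schwarz for the unnormalised weight \<open>e\<close>, obtained by
  integrating the inequality \<open>am\<close> and optimising its parameter at
  \<open>\<eta> = sqrt A\<close>.\<close>

lemma weighted_abs_integral_le:
  fixes X e :: "'a \<Rightarrow> real"
  assumes X [measurable]: "X \<in> borel_measurable M" and e: "integrable M e" "\<And>x. 0 \<le> e x"
    and sq: "integrable M (\<lambda>x. (X x)\<^sup>2 * e x)" and A: "0 \<le> A"
    and le: "(\<integral>x. (X x)\<^sup>2 * e x \<partial>M) \<le> A * (\<integral>x. e x \<partial>M)"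
  shows "integrable M (\<lambda>x. \<bar>X x\<bar> * e x)"
    and "(\<integral>x. \<bar>X x\<bar> * e x \<partial>M) \<le> sqrt A * (\<integral>x. e x \<partial>M)"
proof -
  let ?Z = "\<integral>x. e x \<partial>M"
  have Z: "0 \<le> ?Z" using e by simp
  have [measurable]: "e \<in> borel_measurable M" using e(1) by simp
  have am: "\<bar>x\<bar> \<le> 1 / (2 * \<eta>) * x\<^sup>2 + \<eta> / 2" if "\<eta> > 0" for x \<eta> :: real
  proof -
    have "0 \<le> (\<bar>x\<bar> - \<eta>)\<^sup>2 / (2 * \<eta>)" using that by simp
    also have "\<dots> = 1 / (2 * \<eta>) * x\<^sup>2 + \<eta> / 2 - \<bar>x\<bar>"
      using that by (simp add: power2_diff divide_simps) (simp add: power2_eq_square algebra_simps)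
    finally show ?thesis by simp
  qed
  have pt: "\<bar>X x\<bar> * e x \<le> 1 / (2 * \<eta>) * ((X x)\<^sup>2 * e x) + \<eta> / 2 * e x" if "\<eta> > 0" for x \<eta>
    using mult_right_mono[OF am[OF that, of "X x"] e(2)[of x]] by (simp add: algebra_simps)
  show int: "integrable M (\<lambda>x. \<bar>X x\<bar> * e x)"
  proof (rule Bochner_Integration.integrable_bound)
    show "integrable M (\<lambda>x. 1 / (2 * 1) * ((X x)\<^sup>2 * e x) + 1 / 2 * e x)"
      using sq e(1) by (intro Bochner_Integration.integrable_add integrable_mult_right)
    show "AE x in M. norm (\<bar>X x\<bar> * e x) \<le> norm (1 / (2 * 1) * ((X x)\<^sup>2 * e x) + 1 / 2 * e x)"
      using pt[of 1] e(2) by (intro AE_I2) (auto intro!: order_trans[OF _ abs_ge_self] simp: abs_mult)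
  qed simp
  have bound: "(\<integral>x. \<bar>X x\<bar> * e x \<partial>M) \<le> (A / (2 * \<eta>) + \<eta> / 2) * ?Z" if "\<eta> > 0" for \<eta>
  proof -
    have "(\<integral>x. \<bar>X x\<bar> * e x \<partial>M) \<le> (\<integral>x. 1 / (2 * \<eta>) * ((X x)\<^sup>2 * e x) + \<eta> / 2 * e x \<partial>M)"
      using pt[OF that] int sq e(1) by (intro integral_mono) auto
    also have "\<dots> = 1 / (2 * \<eta>) * (\<integral>x. (X x)\<^sup>2 * e x \<partial>M) + \<eta> / 2 * ?Z"
      using sq e(1) by simp
    also have "\<dots> \<le> 1 / (2 * \<eta>) * (A * ?Z) + \<eta> / 2 * ?Z"
      using le that by (intro add_right_mono mult_left_mono) auto
    finally show ?thesis by (simp add: algebra_simps)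
  qed
  show "(\<integral>x. \<bar>X x\<bar> * e x \<partial>M) \<le> sqrt A * ?Z"
  proof (cases "A = 0")
    case False
    then have "A / (2 * sqrt A) + sqrt A / 2 = sqrt A"
      using A by (simp add: field_simps)
    then show ?thesis using bound[of "sqrt A"] A False by simp
  next
    \<comment> \<open>There is no admissible optimum at \<open>A = 0\<close>, so
      \<open>\<eta>\<close> tends to 0 instead; the \<open>+ 1\<close> keeps the denominator
      positive even if the total mass is 0.\<close>
    case True
    have "(\<integral>x. \<bar>X x\<bar> * e x \<partial>M) \<le> 0 + \<epsilon>" if "\<epsilon> > 0" for \<epsilon>
    proof -
      have "(\<integral>x. \<bar>X x\<bar> * e x \<partial>M) \<le> \<epsilon> / (2 * (?Z + 1)) * ?Z"
        using bound[of "\<epsilon> / (?Z + 1)"] True that Z by (simp add: mult_ac)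
      also have "\<dots> \<le> \<epsilon>" using that Z by (simp add: field_simps)
      finally show ?thesis by simp
    qed
    then have "(\<integral>x. \<bar>X x\<bar> * e x \<partial>M) \<le> 0" by (rule field_le_epsilon)
    then show ?thesis using True by simp
  qed
qed

lemma radial_deviation:
  fixes w :: "'i \<Rightarrow> real"
  assumes fin: "finite I" and card: "2 \<le> card I"
    and w: "\<forall>i\<in>I. w i \<in> {0..b}" and b: "0 \<le> b"
  shows "integrable (gaussian I) (\<lambda>g. \<bar>sqn I g - card I\<bar> * exp (\<kappa> * rayleigh w I g))"
    and "(\<integral>g. \<bar>sqn I g - card I\<bar> * exp (\<kappa> * rayleigh w I g) \<partial>gaussian I)
      \<le> sqrt (2 * real (card I)) * (\<integral>g. exp (\<kappa> * rayleigh w I g) \<partial>gaussian I)"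
proof -
  note [measurable] = measurable_sqn[of I I, OF subset_refl]
  have *: "(\<lambda>g. sqn I g - card I) \<in> borel_measurable (gaussian I)" by measurable
  note cs = weighted_abs_integral_le[OF * exp_rayleigh_integrable[OF fin subset_refl w b, of \<kappa>] _
      radial_moments(2)[OF assms, of \<kappa>], where A = "2 * real (card I)"]
  show "integrable (gaussian I) (\<lambda>g. \<bar>sqn I g - card I\<bar> * exp (\<kappa> * rayleigh w I g))"
    by (rule cs(1)) (use radial_moments(1)[OF assms] in auto)
  show "(\<integral>g. \<bar>sqn I g - card I\<bar> * exp (\<kappa> * rayleigh w I g) \<partial>gaussian I)
      \<le> sqrt (2 * real (card I)) * (\<integral>g. exp (\<kappa> * rayleigh w I g) \<partial>gaussian I)"
    by (rule cs(2)) (use radial_moments(1)[OF assms] in auto)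
qed

text \<open>Integration by parts in the \<open>i\<close>-th direction: the second moment of \<open>g i\<close> is \<open>card I\<close> times
  that of \<open>g i / sqrt (sqn I g)\<close> up to the radial deviation, and replacing the Rayleigh quotient by
  \<open>v\<close> costs \<open>sqrt a\<close>.\<close>

lemma coord_ratio_integral_le:
  fixes w :: "'i \<Rightarrow> real" and \<theta> v c a :: real
  assumes fin: "finite I" and card: "2 \<le> card I" and i: "i \<in> I"
    and w: "\<forall>i\<in>I. w i \<in> {0..b}" and b: "0 \<le> b"
    and c: "c \<le> 1 + 2 * \<theta> * (v - w i)" and a: "0 \<le> a"
    and \<kappa>: "\<kappa> = \<theta> * card I"
    and conc: "(\<integral>g. (rayleigh w I g - v)\<^sup>2 * exp (\<kappa> * rayleigh w I g) \<partial>gaussian I)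
      \<le> a * (\<integral>g. exp (\<kappa> * rayleigh w I g) \<partial>gaussian I)"
  shows "integrable (gaussian I) (\<lambda>g. \<bar>rayleigh w I g - v\<bar> * exp (\<kappa> * rayleigh w I g))"
    and "(\<integral>g. \<bar>rayleigh w I g - v\<bar> * exp (\<kappa> * rayleigh w I g) \<partial>gaussian I)
      \<le> sqrt a * (\<integral>g. exp (\<kappa> * rayleigh w I g) \<partial>gaussian I)"
    and "integrable (gaussian I) (\<lambda>g. (g i)\<^sup>2 / sqn I g * exp (\<kappa> * rayleigh w I g))"
    and "c * real (card I) * (\<integral>g. (g i)\<^sup>2 / sqn I g * exp (\<kappa> * rayleigh w I g) \<partial>gaussian I)
      \<le> (1 + sqrt (2 * real (card I)) + 2 * \<bar>\<theta>\<bar> * real (card I) * sqrt a)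
          * (\<integral>g. exp (\<kappa> * rayleigh w I g) \<partial>gaussian I)"
proof -
  let ?E = "\<lambda>g. exp (\<kappa> * rayleigh w I g)" and ?n = "real (card I)"
  let ?t = "\<lambda>g. (g i)\<^sup>2 / sqn I g" and ?h = "rayleigh w I"
  let ?Z = "\<integral>g. ?E g \<partial>gaussian I"
  note [measurable] = measurable_sqn[of I I, OF subset_refl] measurable_rayleigh[of I I w, OF subset_refl]
    measurable_gaussian_coord[OF i]
  have C0: "C \<le> C * (1 + sqn I g)\<^sup>2" if "0 \<le> C" for C g
    using mult_left_mono[OF one_le_power[of "1 + sqn I g" 2], OF _ that] sqn_nonneg[of I g] by simp
  have bdd: "integrable (gaussian I) (\<lambda>g. f g * ?E g)"
    if "f \<in> borel_measurable (gaussian I)" "\<And>g. \<bar>f g\<bar> \<le> C" for f C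
    by (rule integrable_gaussian_tilt[OF fin that(1) w b subset_refl, where C = C])
       (use C0 that(2) abs_ge_zero order_trans in blast)
  have h: "\<bar>?h g - v\<bar> \<le> b + \<bar>v\<bar>" for g
    using rayleigh_bounds[OF w b, of g] by auto
  have t: "0 \<le> ?t g" "?t g \<le> 1" for g using coord_ratio_bounds[OF fin i, of g] by auto
  have "integrable (gaussian I) (\<lambda>g. (?h g - v)\<^sup>2 * ?E g)"
  proof (rule bdd[where C = "(b + \<bar>v\<bar>)\<^sup>2"])
    fix g show "\<bar>(?h g - v)\<^sup>2\<bar> \<le> (b + \<bar>v\<bar>)\<^sup>2"
      using power_mono[OF h[of g], of 2] by simp
  qed measurable
  from weighted_abs_integral_le[OF _ exp_rayleigh_integrable[OF fin subset_refl w b] _ this a conc]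
  show dev: "integrable (gaussian I) (\<lambda>g. \<bar>?h g - v\<bar> * ?E g)"
    and dev_le: "(\<integral>g. \<bar>?h g - v\<bar> * ?E g \<partial>gaussian I) \<le> sqrt a * ?Z"
    by auto
  show int_t: "integrable (gaussian I) (\<lambda>g. ?t g * ?E g)"
    by (rule bdd[where C = 1]) (use t in \<open>auto simp: sqn_nonneg\<close>)
  have int_tv: "integrable (gaussian I) (\<lambda>g. (?t g * (?h g - v)) * ?E g)"
  proof (rule bdd[where C = "1 * (b + \<bar>v\<bar>)"])
    fix g show "\<bar>?t g * (?h g - v)\<bar> \<le> 1 * (b + \<bar>v\<bar>)"
      unfolding abs_mult using t[of g] h[of g] by (intro mult_mono) auto
  qed measurable
  have t_le: "\<bar>?t g * y * ?E g\<bar> \<le> \<bar>y\<bar> * ?E g" for g y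
    unfolding abs_mult abs_of_nonneg[OF t(1)] abs_exp_cancel
    by (intro mult_right_mono mult_left_le_one_le t) auto
  have tQ: "?t g * sqn I g = (g i)\<^sup>2" for g
    using sqn_ge_coord[OF fin i, of g] by auto
  note rad = radial_deviation[OF fin card w b, of \<kappa>]
  have int_rad: "integrable (gaussian I) (\<lambda>g. ?t g * (sqn I g - ?n) * ?E g)"
  proof (rule Bochner_Integration.integrable_bound[OF rad(1)])
    show "AE g in gaussian I. norm (?t g * (sqn I g - ?n) * ?E g) \<le> norm (\<bar>sqn I g - ?n\<bar> * ?E g)"
      unfolding real_norm_def by (intro AE_I2 order_trans[OF t_le abs_ge_self])
  qed measurable
  note ibp = ibp_coord[OF fin i card w b, where \<alpha> = 1 and \<beta> = 0 and \<kappa> = \<kappa>]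
  have lin: "(\<integral>x. f1 x - f2 x + f3 x - f4 x - k * f5 x \<partial>M) = integral\<^sup>L M f1 - integral\<^sup>L M f2
      + integral\<^sup>L M f3 - integral\<^sup>L M f4 - k * integral\<^sup>L M f5"
    if "integrable M f1" "integrable M f2" "integrable M f3" "integrable M f4" "integrable M f5"
    for f1 f2 f3 f4 f5 :: "('i \<Rightarrow> real) \<Rightarrow> real" and M k
    using that by simp
  \<comment> \<open>The first two summands are kept in the shape of the two sides of
    \<open>ibp\<close>, hence the factors \<open>0 * Q\<close>. Their integrals cancel, leaving the
    mass, the radial error and the error of replacing \<open>h\<close> by \<open>v\<close>.\<close>
  have split: "?n * (1 + 2 * \<theta> * (v - w i)) * (t * e)
      = (t * Q - 1) * (1 + 0 * Q) * e - (2 * 0 * (t * Q) + (1 + 0 * Q) * (2 * \<kappa>) * t * (w i - h)) * e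
        + e - t * (Q - ?n) * e - 2 * \<theta> * ?n * (t * (h - v) * e)" for t e Q h
    unfolding \<kappa> by (simp add: algebra_simps)
  have eq: "?n * (1 + 2 * \<theta> * (v - w i)) * (?t g * ?E g)
      = ((g i)\<^sup>2 - 1) * (1 + 0 * sqn I g) * ?E g
        - (2 * 0 * (g i)\<^sup>2 + (1 + 0 * sqn I g) * (2 * \<kappa>) * ?t g * (w i - ?h g)) * ?E g
        + ?E g - ?t g * (sqn I g - ?n) * ?E g - 2 * \<theta> * ?n * (?t g * (?h g - v) * ?E g)" for g
    by (rule split[of "?t g" _ "sqn I g", unfolded tQ])
  have "?n * (1 + 2 * \<theta> * (v - w i)) * (\<integral>g. ?t g * ?E g \<partial>gaussian I)
      = (\<integral>g. ?n * (1 + 2 * \<theta> * (v - w i)) * (?t g * ?E g) \<partial>gaussian I)"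
    by (rule integral_mult_right_zero[symmetric])
  also have "\<dots> = (\<integral>g. ((g i)\<^sup>2 - 1) * (1 + 0 * sqn I g) * ?E g
        - (2 * 0 * (g i)\<^sup>2 + (1 + 0 * sqn I g) * (2 * \<kappa>) * ?t g * (w i - ?h g)) * ?E g
        + ?E g - ?t g * (sqn I g - ?n) * ?E g - 2 * \<theta> * ?n * (?t g * (?h g - v) * ?E g) \<partial>gaussian I)"
    by (simp only: eq)
  also have "\<dots> = ?Z - (\<integral>g. ?t g * (sqn I g - ?n) * ?E g \<partial>gaussian I)
      - 2 * \<theta> * ?n * (\<integral>g. ?t g * (?h g - v) * ?E g \<partial>gaussian I)"
    using lin[OF ibp(2,3) exp_rayleigh_integrable[OF fin subset_refl w b] int_rad int_tv]
    by (simp only: ibp(1) diff_self add_0_left)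
  also have "\<dots> \<le> ?Z + sqrt (2 * ?n) * ?Z + 2 * \<bar>\<theta>\<bar> * ?n * (sqrt a * ?Z)"
  proof -
    have "\<bar>\<integral>g. ?t g * (sqn I g - ?n) * ?E g \<partial>gaussian I\<bar>
        \<le> (\<integral>g. \<bar>?t g * (sqn I g - ?n) * ?E g\<bar> \<partial>gaussian I)" by (rule integral_abs_bound)
    also have "\<dots> \<le> (\<integral>g. \<bar>sqn I g - ?n\<bar> * ?E g \<partial>gaussian I)"
      using int_rad rad(1) t_le by (intro integral_mono integrable_abs)
    also have "\<dots> \<le> sqrt (2 * ?n) * ?Z" by (rule rad(2))
    finally have 1: "\<bar>\<integral>g. ?t g * (sqn I g - ?n) * ?E g \<partial>gaussian I\<bar> \<le> sqrt (2 * ?n) * ?Z" .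
    have "\<bar>\<integral>g. ?t g * (?h g - v) * ?E g \<partial>gaussian I\<bar>
        \<le> (\<integral>g. \<bar>?t g * (?h g - v) * ?E g\<bar> \<partial>gaussian I)" by (rule integral_abs_bound)
    also have "\<dots> \<le> (\<integral>g. \<bar>?h g - v\<bar> * ?E g \<partial>gaussian I)"
      using int_tv dev t_le by (intro integral_mono integrable_abs)
    also have "\<dots> \<le> sqrt a * ?Z" by (rule dev_le)
    finally have "\<bar>2 * \<theta> * ?n * (\<integral>g. ?t g * (?h g - v) * ?E g \<partial>gaussian I)\<bar>
        \<le> 2 * \<bar>\<theta>\<bar> * ?n * (sqrt a * ?Z)"
      by (simp add: abs_mult mult_left_mono)
    with 1 show ?thesis by linarith
  qed
  finally have "?n * (1 + 2 * \<theta> * (v - w i)) * (\<integral>g. ?t g * ?E g \<partial>gaussian I)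
      \<le> (1 + sqrt (2 * ?n) + 2 * \<bar>\<theta>\<bar> * ?n * sqrt a) * ?Z"
    by (simp add: algebra_simps)
  moreover have "c * ?n * (\<integral>g. ?t g * ?E g \<partial>gaussian I)
      \<le> (1 + 2 * \<theta> * (v - w i)) * ?n * (\<integral>g. ?t g * ?E g \<partial>gaussian I)"
    by (intro mult_right_mono c Bochner_Integration.integral_nonneg mult_nonneg_nonneg t) auto
  ultimately show "c * ?n * (\<integral>g. ?t g * ?E g \<partial>gaussian I)
      \<le> (1 + sqrt (2 * ?n) + 2 * \<bar>\<theta>\<bar> * ?n * sqrt a) * ?Z"
    by (simp add: mult_ac)
qed

subsection \<open>Comparison of the two weights\<close>

lemma abs_exp_diff_le:
  fixes p q m :: real
  assumes "p \<le> m" "q \<le> m" shows "\<bar>exp p - exp q\<bar> \<le> \<bar>p - q\<bar> * exp m"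
proof -
  have *: "exp p - exp q \<le> \<bar>p - q\<bar> * exp m" if "p \<le> m" for p q :: real
  proof -
    have "exp p - exp q = exp p * (1 - exp (q - p))"
      by (simp add: algebra_simps exp_add[symmetric])
    also have "\<dots> \<le> exp p * \<bar>p - q\<bar>"
      using exp_ge_add_one_self[of "q - p"] by (intro mult_left_mono) (linarith, simp)
    also have "\<dots> \<le> exp m * \<bar>p - q\<bar>" using that by (intro mult_right_mono) auto
    finally show ?thesis by (simp add: mult.commute)
  qed
  from *[OF assms(1), of q] *[OF assms(2), of p] show ?thesis
    by (intro abs_leI) (simp_all add: abs_minus_commute)
qed

text \<open>The polynomial is paid for with half of the margin \<open>c / 4\<close>. The constant
  comes from \<open>1 + y \<le> 16 / c * exp (c / 16 * y)\<close>, whose square costs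
  \<open>c / 8\<close> in the exponent.\<close>

lemma poly_exp_le:
  fixes c y :: real
  assumes c: "0 < c" "c \<le> 1" and y: "0 \<le> y"
  shows "(1 + y)\<^sup>2 * exp ((1/2 - c/4) * y) \<le> (16 / c)\<^sup>2 * exp ((1/2 - c/8) * y)"
proof -
  have "1 + y \<le> 16 / c * (1 + c / 16 * y)" using c by (simp add: field_simps)
  also have "\<dots> \<le> 16 / c * exp (c / 16 * y)"
    using c exp_ge_add_one_self[of "c / 16 * y"] by (intro mult_left_mono) auto
  finally have "(1 + y)\<^sup>2 \<le> (16 / c * exp (c / 16 * y))\<^sup>2" using y by (intro power_mono) auto
  also have "\<dots> = (16 / c)\<^sup>2 * exp (c / 8 * y)"
    unfolding power_mult_distrib exp_double[symmetric] by simp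
  finally have "(1 + y)\<^sup>2 * exp ((1/2 - c/4) * y) \<le> (16 / c)\<^sup>2 * exp (c / 8 * y) * exp ((1/2 - c/4) * y)"
    by (intro mult_right_mono) auto
  also have "\<dots> = (16 / c)\<^sup>2 * exp ((1/2 - c/8) * y)"
    by (simp add: mult.assoc exp_add[symmetric] algebra_simps)
  finally show ?thesis .
qed

text \<open>A coordinate with \<open>y \<le> 1\<close> has weight
  \<open>y / (s + y) \<le> 2 / N\<close> in the average \<open>h\<close>, so it shifts
  \<open>h\<close> by at most \<open>2 * b / N\<close>, and the exponent by a bounded amount after
  multiplication by \<open>N\<close>.\<close>

lemma pointwise_lower_comparison:
  fixes s y hb w b v \<theta> N \<epsilon> h :: real
  assumes s: "\<bar>s / N - 1\<bar> \<le> \<epsilon>" and y: "0 \<le> y" "y \<le> 1" and hb: "0 \<le> hb" "hb \<le> b"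
    and w: "0 \<le> w" "w \<le> b" and N: "0 < N" and \<epsilon>: "\<epsilon> \<le> 1/2"
    and h_def: "h = (hb * s + w * y) / (s + y)"
  shows "exp (- 2 * \<bar>\<theta>\<bar> * b) * exp (\<theta> * N * hb) \<le> exp (\<theta> * N * h)"
    and "\<bar>hb - v\<bar> \<le> \<bar>h - v\<bar> + 2 * b / N"
proof -
  have sN: "1 / 2 \<le> s / N" using s \<epsilon> by linarith
  then have s0: "N \<le> 2 * s" using N by (simp add: field_simps)
  then have sy: "0 < s + y" "N \<le> 2 * (s + y)" using N y by auto
  have "h - hb = (w - hb) * (y / (s + y))" using sy by (simp add: h_def field_simps)
  also have "\<bar>\<dots>\<bar> \<le> b * (2 / N)"
  proof -
    have "y / (s + y) \<le> 2 / N" using y sy N mult_mono[of y 1 N "2 * (s + y)"]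
      by (simp add: divide_simps mult_ac)
    then show ?thesis unfolding abs_mult using y sy w hb by (intro mult_mono) auto
  qed
  finally have d: "\<bar>h - hb\<bar> \<le> 2 * b / N" by (simp add: mult_ac)
  then show "\<bar>hb - v\<bar> \<le> \<bar>h - v\<bar> + 2 * b / N" by linarith
  have "\<bar>\<theta> * N * (h - hb)\<bar> \<le> \<bar>\<theta>\<bar> * N * (2 * b / N)"
    unfolding abs_mult using d N by (intro mult_mono) auto
  also have "\<dots> = 2 * \<bar>\<theta>\<bar> * b" using N by simp
  finally have "- (2 * \<bar>\<theta>\<bar> * b) \<le> \<theta> * N * (h - hb)" by (rule abs_le_D2[THEN iffD1[OF minus_le_iff]])
  then show "exp (- 2 * \<bar>\<theta>\<bar> * b) * exp (\<theta> * N * hb) \<le> exp (\<theta> * N * h)"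
    by (simp add: exp_add[symmetric] right_diff_distrib)
qed

text \<open>Here \<open>y\<close> is the squared decoupled coordinate, \<open>s\<close> the squared norm of the others, and \<open>h\<close>, \<open>hb\<close>
  are the Rayleigh quotients with and without that coordinate. The exponents differ by
  \<open>\<theta> * y * ((N / s - 1) * (w - h) + (v - h))\<close>, which is small relative to \<open>c * y\<close> if \<open>s / N\<close> is near \<open>1\<close> and
  \<open>h\<close> is near \<open>v\<close>; otherwise one of the quantities in \<open>X1\<close> and \<open>X2\<close> is bounded below.\<close>

lemma pointwise_comparison:
  fixes s y hb w b v \<theta> N c \<delta> \<epsilon> h B E1 E2 X1 X2 u :: real and good :: bool
  assumes s: "0 < s" and y: "0 \<le> y" and hb: "0 \<le> hb" "hb \<le> b" and w: "0 \<le> w" "w \<le> b"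
    and N: "0 < N" and c: "0 < c" "c \<le> 1" "c \<le> 1 + 2 * \<theta> * (v - w)"
    and \<epsilon>: "0 < \<epsilon>" "\<epsilon> \<le> 1/2" "2 * \<bar>\<theta>\<bar> * b * \<epsilon> \<le> c / 8" and \<delta>: "0 < \<delta>" "\<bar>\<theta>\<bar> * \<delta> \<le> c / 8"
    and h_def: "h = (hb * s + w * y) / (s + y)"
    and B_def: "B = exp (\<theta> * N * hb)"
    and good_def: "good = (\<bar>s / N - 1\<bar> \<le> \<epsilon>)"
    and E1_def: "E1 = exp (\<theta> * N * h)"
    and E2_def: "E2 = B * exp (- \<theta> * (v - w) * y)"
    and X1_def: "X1 = \<bar>h - v\<bar> + \<bar>(s + y) / N - 1\<bar> + y / (s + y)"
    and X2_def: "X2 = \<bar>s / N - 1\<bar> + (if good then \<bar>hb - v\<bar> else 0) + 1 / N"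
    and u_def: "u = exp ((1/2 - c/8) * y)"
  shows "\<bar>E1 - E2\<bar> \<le> (2 / \<epsilon> + 1 / \<delta>) * (X1 * E1)
      + (1 / \<epsilon> + (16 / c)\<^sup>2 * (1 + 2 * b) * (1 / \<delta> + \<bar>\<theta>\<bar>)) * (u * (X2 * B))"
    (is "_ \<le> ?A1 * _ + ?A2 * _")
proof -
  let ?ub = "exp ((1/2 - c/4) * y)" and ?K = "(16 / c)\<^sup>2"
  have b: "0 \<le> b" using w by simp
  have sy: "0 < s + y" using s y by simp
  have B: "0 < B" by (simp add: B_def)
  have h: "0 \<le> h" "h \<le> b"
  proof -
    have "hb * s + w * y \<le> b * s + b * y" using s y hb w by (intro add_mono mult_right_mono) auto
    then show "0 \<le> h" "h \<le> b" using sy s y hb w by (auto simp: h_def divide_le_eq algebra_simps)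
  qed
  have X1: "0 \<le> X1" using y sy by (auto simp: X1_def)
  have X2: "0 \<le> X2" using N by (auto simp: X2_def)
  have A1: "0 \<le> 2 / \<epsilon>" "0 \<le> 1 / \<delta>" using \<epsilon> \<delta> by auto
  have A2: "0 \<le> 1 / \<epsilon>" "0 \<le> ?K * (1 + 2 * b) * (1 / \<delta>)" "0 \<le> ?K * (1 + 2 * b) * \<bar>\<theta>\<bar>" using \<epsilon> \<delta> b by auto
  have E2: "E2 \<le> B * ?ub"
  proof -
    have "- \<theta> * (v - w) * y \<le> (1/2 - c/4) * y"
      using c y by (intro mult_right_mono) (auto simp: algebra_simps)
    then show ?thesis using B by (simp add: E2_def)
  qed
  have u0: "?ub \<le> u" using c y by (auto simp: u_def intro!: mult_right_mono)
  have u: "0 < u" by (simp add: u_def)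
  have E: "0 < E1" "0 < E2" using B by (simp_all add: E1_def E2_def)
  then have diff: "\<bar>E1 - E2\<bar> \<le> E1 + E2" by linarith
  have poly: "(1 + y)\<^sup>2 * ?ub \<le> ?K * u" using poly_exp_le[OF c(1,2) y] by (simp add: u_def)
  have combine: ?thesis if "\<bar>E1 - E2\<bar> \<le> a1 * (X1 * E1) + a2 * (u * (X2 * B))"
    "a1 \<le> ?A1" "a2 \<le> ?A2" for a1 a2
  proof -
    have "a1 * (X1 * E1) \<le> ?A1 * (X1 * E1)"
      using that(2) X1 E by (intro mult_right_mono) auto
    moreover have "a2 * (u * (X2 * B)) \<le> ?A2 * (u * (X2 * B))"
      using that(3) X2 B u by (intro mult_right_mono) auto
    ultimately show ?thesis using that(1) by linarith
  qed
  show ?thesis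
  proof (cases good)
    case False
    then have bad: "1 \<le> 1 / \<epsilon> * \<bar>s / N - 1\<bar>" using \<epsilon> by (simp add: good_def divide_simps)
    \<comment> \<open>The Gibbs weight must be charged to the full norm \<open>s + y\<close>. The
      difference \<open>y / N\<close> is itself at most the coordinate ratio plus the deviation of
      the full norm.\<close>
    have "\<bar>s / N - 1\<bar> \<le> 2 * X1"
    proof -
      have "y / N = y / (s + y) * ((s + y) / N)" using sy by simp
      also have "\<dots> \<le> y / (s + y) * (1 + \<bar>(s + y) / N - 1\<bar>)"
        using y sy by (intro mult_left_mono) auto
      also have "\<dots> \<le> y / (s + y) + 1 * \<bar>(s + y) / N - 1\<bar>"
        unfolding distrib_left using y sy s by (intro add_mono mult_right_mono) auto
      finally have 1: "y / N \<le> y / (s + y) + \<bar>(s + y) / N - 1\<bar>" by simp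
      have 2: "s / N - 1 = ((s + y) / N - 1) - y / N" by (simp add: add_divide_distrib)
      have 3: "0 \<le> y / N" "0 \<le> y / (s + y)" using y N sy by auto
      have tri: "\<bar>p - q\<bar> \<le> 2 * (e + \<bar>p\<bar> + r)" if "q \<le> r + \<bar>p\<bar>" "0 \<le> q" "0 \<le> r" "0 \<le> e"
        for p q r e :: real using that by (smt (verit))
      show ?thesis unfolding X1_def 2 by (rule tri[OF 1 3 abs_ge_zero])
    qed
    then have "1 \<le> 2 / \<epsilon> * X1"
      using order_trans[OF bad mult_left_mono[of "\<bar>s / N - 1\<bar>" "2 * X1" "1 / \<epsilon>"]] \<epsilon> by simp
    then have e1: "E1 \<le> 2 / \<epsilon> * (X1 * E1)"
      using mult_right_mono[of 1 "2 / \<epsilon> * X1" E1] E by (simp add: mult.assoc)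
    have "\<bar>s / N - 1\<bar> \<le> X2" using N by (auto simp: X2_def)
    then have "1 \<le> 1 / \<epsilon> * X2"
      using order_trans[OF bad mult_left_mono[of "\<bar>s / N - 1\<bar>" X2 "1 / \<epsilon>"]] \<epsilon> by simp
    then have "B * u \<le> 1 / \<epsilon> * (u * (X2 * B))"
      using mult_right_mono[of 1 "1 / \<epsilon> * X2" "B * u"] B u by (simp add: mult_ac)
    moreover have "E2 \<le> B * u" using order_trans[OF E2 mult_left_mono[OF u0]] B by simp
    ultimately show ?thesis
      using diff e1 A1 A2 by (intro combine[of "2 / \<epsilon>" "1 / \<epsilon>"]) (auto simp: distrib_left)
  next
    case True
    have sN: "1 / 2 \<le> s / N" using True \<epsilon> unfolding good_def by linarith
    then have Ns: "N / s \<le> 2" using N s by (simp add: field_simps)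
    have h_hb: "\<bar>h - hb\<bar> \<le> 2 * b * (y / N)"
    proof -
      have "h - hb = (w - hb) * (y / (s + y))" using sy by (simp add: h_def field_simps)
      also have "\<bar>\<dots>\<bar> \<le> b * (y / s)"
        unfolding abs_mult using y s sy w hb by (intro mult_mono) (auto intro!: divide_left_mono)
      also have "b * (y / s) = b * (y / N) * (N / s)" using N by simp
      also have "\<dots> \<le> b * (y / N) * 2" using Ns b y N by (intro mult_left_mono) auto
      finally show ?thesis by (simp add: mult_ac)
    qed
    \<comment> \<open>\<open>X2\<close> has to be free of \<open>y\<close> so that Fubini factors
      the integral. Trading \<open>h\<close> for \<open>hb\<close> costs a factor
      \<open>1 + y\<close>, which \<open>poly_exp_le\<close> absorbs later.\<close>
    have h_v: "\<bar>h - v\<bar> \<le> (1 + 2 * b) * (1 + y) * (\<bar>hb - v\<bar> + 1 / N)"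
    proof -
      have "\<bar>h - v\<bar> \<le> \<bar>hb - v\<bar> + 2 * b * (y / N)" using h_hb by linarith
      also have "\<dots> \<le> (1 + 2 * b) * (1 + y) * (\<bar>hb - v\<bar> + 1 / N)"
      proof -
        have "1 * \<bar>hb - v\<bar> \<le> (1 + 2 * b) * (1 + y) * \<bar>hb - v\<bar>"
          using b y by (intro mult_right_mono) (auto simp: algebra_simps)
        moreover have "(2 * b) * y * (1 / N) \<le> (1 + 2 * b) * (1 + y) * (1 / N)"
          using b y N by (intro mult_right_mono mult_mono) auto
        ultimately show ?thesis by (simp add: distrib_left)
      qed
      finally show ?thesis .
    qed
    have X2_ge: "\<bar>hb - v\<bar> + 1 / N \<le> X2" using True by (simp add: X2_def)
    have poly1: "(1 + y) * ?ub \<le> ?K * u"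
    proof -
      have "(1 + y) * ?ub \<le> (1 + y)\<^sup>2 * ?ub"
        using y by (intro mult_right_mono) (auto simp: self_le_power)
      then show ?thesis using poly by (rule order_trans)
    qed
    show ?thesis
    proof (cases "\<bar>h - v\<bar> \<le> \<delta>")
      case False
      \<comment> \<open>With \<open>h\<close> far from \<open>v\<close> the exponents need not be
        close, so no cancellation is sought: both weights are bounded separately, using that
        \<open>\<bar>h - v\<bar> / \<delta>\<close> exceeds 1.\<close>
      then have far: "1 \<le> 1 / \<delta> * \<bar>h - v\<bar>" using \<delta> by (simp add: divide_simps)
      have "\<bar>h - v\<bar> \<le> X1" using y sy by (simp add: X1_def)
      then have "1 \<le> 1 / \<delta> * X1"
        using order_trans[OF far mult_left_mono[of "\<bar>h - v\<bar>" X1 "1 / \<delta>"]] \<delta> by simp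
      then have e1: "E1 \<le> 1 / \<delta> * (X1 * E1)"
        using mult_right_mono[of 1 "1 / \<delta> * X1" E1] E by (simp add: mult.assoc)
      have "E2 \<le> B * ?ub * (1 / \<delta> * \<bar>h - v\<bar>)"
        using E2 mult_left_mono[OF far, of "B * ?ub"] B by simp
      also have "\<dots> \<le> B * ?ub * (1 / \<delta> * ((1 + 2 * b) * (1 + y) * X2))"
        using order_trans[OF h_v mult_left_mono[OF X2_ge]] B \<delta> b y
        by (intro mult_left_mono) auto
      also have "\<dots> = (1 + 2 * b) * (1 / \<delta>) * ((1 + y) * ?ub) * (X2 * B)" by simp
      also have "\<dots> \<le> (1 + 2 * b) * (1 / \<delta>) * (?K * u) * (X2 * B)"
        using poly1 b \<delta> B X2 by (intro mult_right_mono mult_left_mono) auto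
      also have "\<dots> = ?K * (1 + 2 * b) * (1 / \<delta>) * (u * (X2 * B))" by (simp add: mult_ac)
      finally show ?thesis
        using diff e1 A1 A2
        by (intro combine[of "1 / \<delta>" "?K * (1 + 2 * b) * (1 / \<delta>)"]) (auto simp: distrib_left)
    next
      case near: True
      have Ns_abs: "\<bar>N / s - 1\<bar> \<le> 2 * \<bar>s / N - 1\<bar>"
      proof -
        have "N / s - 1 = (1 - s / N) * (N / s)" using N s by (simp add: field_simps)
        then have "\<bar>N / s - 1\<bar> = \<bar>s / N - 1\<bar> * (N / s)"
          using N s by (simp add: abs_mult abs_minus_commute)
        also have "\<dots> \<le> \<bar>s / N - 1\<bar> * 2" using Ns by (intro mult_left_mono) auto
        finally show ?thesis by simp
      qed
      have hw: "\<bar>w - h\<bar> \<le> b" using h w by auto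
      have dev: "\<bar>(N / s - 1) * (w - h)\<bar> \<le> 2 * \<bar>s / N - 1\<bar> * b"
        unfolding abs_mult using Ns_abs hw b by (intro mult_mono) auto
      have "(h - hb) * s = (w - h) * y" using sy by (simp add: h_def field_simps)
      \<comment> \<open>Solving the averaging relation with \<open>h\<close> on the right puts the
        plain \<open>s\<close> in the denominator. The exponent difference becomes exactly linear in
        \<open>N / s\<close> and \<open>w - h\<close>, the quantities controlled in this
        case.\<close>
      then have shift: "h - hb = y * (w - h) / s" using s by (simp add: field_simps)
      have "\<theta> * N * h = \<theta> * N * hb + \<theta> * N * (h - hb)" by (simp add: algebra_simps)
      then have H: "\<theta> * N * h = \<theta> * N * hb + \<theta> * ((N / s) * (w - h)) * y"
        unfolding shift by (simp add: mult_ac)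
      have e2: "E2 = exp (\<theta> * N * hb + - \<theta> * (v - w) * y)" by (simp only: E2_def B_def exp_add)
      let ?m = "\<theta> * N * hb + (1/2 - c/4) * y"
      \<comment> \<open>The precision bound gives \<open>1/2 - c/2\<close>; replacing
        \<open>h\<close> by \<open>v\<close> and \<open>N / s\<close> by 1 adds at most
        \<open>c / 8\<close> each, which is how \<open>\<delta>\<close> and
        \<open>\<epsilon>\<close> were restricted.\<close>
      have "\<theta> * ((N / s) * (w - h)) \<le> 1/2 - c/4"
      proof -
        have "\<theta> * ((N / s) * (w - h)) = - \<theta> * (v - w) + \<theta> * (v - h) + \<theta> * ((N / s - 1) * (w - h))"
          by (simp add: algebra_simps)
        moreover have "- \<theta> * (v - w) \<le> 1/2 - c/2" using c(3) by (simp add: algebra_simps)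
        moreover have "\<theta> * (v - h) \<le> c / 8"
        proof -
          have "\<theta> * (v - h) \<le> \<bar>\<theta>\<bar> * \<bar>h - v\<bar>" by (metis abs_ge_self abs_minus_commute abs_mult)
          also have "\<dots> \<le> \<bar>\<theta>\<bar> * \<delta>" using near by (intro mult_left_mono) auto
          finally show ?thesis using \<delta> by simp
        qed
        moreover have "\<theta> * ((N / s - 1) * (w - h)) \<le> c / 8"
        proof -
          have "\<theta> * ((N / s - 1) * (w - h)) \<le> \<bar>\<theta>\<bar> * \<bar>(N / s - 1) * (w - h)\<bar>"
            by (metis abs_ge_self abs_mult)
          also have "\<dots> \<le> \<bar>\<theta>\<bar> * (2 * \<epsilon> * b)"
            using order_trans[OF dev, of "2 * \<epsilon> * b"] True b
            by (intro mult_left_mono) (auto simp: good_def intro!: mult_right_mono)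
          also have "\<dots> = 2 * \<bar>\<theta>\<bar> * b * \<epsilon>" by simp
          also note \<epsilon>(3)
          finally show ?thesis .
        qed
        ultimately show ?thesis by simp
      qed
      then have m1: "\<theta> * N * h \<le> ?m" unfolding H using y by (intro add_left_mono mult_right_mono)
      have m2: "\<theta> * N * hb + - \<theta> * (v - w) * y \<le> ?m"
        using c y by (intro add_left_mono mult_right_mono) (auto simp: algebra_simps)
      have "\<bar>E1 - E2\<bar> \<le> \<bar>\<theta> * N * h - (\<theta> * N * hb + - \<theta> * (v - w) * y)\<bar> * exp ?m"
        unfolding e2 E1_def by (rule abs_exp_diff_le[OF m1 m2])
      also have "\<theta> * N * h - (\<theta> * N * hb + - \<theta> * (v - w) * y)
          = \<theta> * ((v - h) + (N / s - 1) * (w - h)) * y"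
        unfolding H by (simp add: algebra_simps)
      also have "\<bar>\<dots>\<bar> * exp ?m \<le> (\<bar>\<theta>\<bar> * ((1 + 2 * b) * (1 + y) * X2) * (1 + y)) * (B * ?ub)"
      proof -
        have "\<bar>(v - h) + (N / s - 1) * (w - h)\<bar> \<le> (1 + 2 * b) * (1 + y) * X2"
        proof -
          have "2 * b * \<bar>s / N - 1\<bar> \<le> (1 + 2 * b) * (1 + y) * \<bar>s / N - 1\<bar>"
            using b y by (intro mult_right_mono) (auto simp: algebra_simps)
          then have 1: "\<bar>h - v\<bar> + 2 * \<bar>s / N - 1\<bar> * b \<le> (1 + 2 * b) * (1 + y) * ((\<bar>hb - v\<bar> + 1 / N) + \<bar>s / N - 1\<bar>)"
            unfolding distrib_left[of _ "\<bar>hb - v\<bar> + 1 / N"] using h_v by (simp add: mult_ac)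
          have "\<bar>(v - h) + (N / s - 1) * (w - h)\<bar> \<le> \<bar>h - v\<bar> + \<bar>(N / s - 1) * (w - h)\<bar>"
            using abs_triangle_ineq[of "v - h"] by (simp only: abs_minus_commute[of v h])
          also have "\<dots> \<le> \<bar>h - v\<bar> + 2 * \<bar>s / N - 1\<bar> * b" using dev by (rule add_left_mono)
          also note 1
          also have "(\<bar>hb - v\<bar> + 1 / N) + \<bar>s / N - 1\<bar> = X2" using True by (simp add: X2_def)
          finally show ?thesis .
        qed
        then have "\<bar>\<theta> * ((v - h) + (N / s - 1) * (w - h)) * y\<bar> \<le> \<bar>\<theta>\<bar> * ((1 + 2 * b) * (1 + y) * X2) * (1 + y)"
          unfolding abs_mult using y b X2 by (intro mult_mono) auto
        then show ?thesis
          by (simp add: B_def exp_add mult_right_mono)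
      qed
      also have "\<dots> = (1 + 2 * b) * \<bar>\<theta>\<bar> * ((1 + y)\<^sup>2 * ?ub) * (X2 * B)"
        by (simp add: power2_eq_square mult_ac)
      also have "\<dots> \<le> (1 + 2 * b) * \<bar>\<theta>\<bar> * (?K * u) * (X2 * B)"
        using poly b B X2 by (intro mult_right_mono mult_left_mono) auto
      also have "\<dots> = ?K * (1 + 2 * b) * \<bar>\<theta>\<bar> * (u * (X2 * B))" by (simp add: mult_ac)
      finally show ?thesis
        using A1 A2 by (intro combine[of 0 "?K * (1 + 2 * b) * \<bar>\<theta>\<bar>"]) (auto simp: distrib_left)
    qed
  qed
qed

section \<open>Integrating the pointwise comparison\<close>

lemma gaussian_insert_product:
  fixes f :: "('i \<Rightarrow> real) \<Rightarrow> real" and u :: "real \<Rightarrow> real"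
  assumes J: "finite J" "d \<notin> J" and f: "integrable (gaussian J) f"
    and f_meas: "f \<in> borel_measurable (gaussian (insert d J))"
    and f_upd: "\<And>g x. f (g(d := x)) = f g" and u: "integrable std_normal_distribution u"
  shows "integrable (gaussian (insert d J)) (\<lambda>g. u (g d) * f g)"
    and "(\<integral>g. u (g d) * f g \<partial>gaussian (insert d J))
      = (\<integral>x. u x \<partial>std_normal_distribution) * (\<integral>g. f g \<partial>gaussian J)"
proof -
  note [measurable] = f_meas
  have [measurable]: "f \<in> borel_measurable (gaussian J)" "u \<in> borel_measurable std_normal_distribution"
    using f u by auto
  have [measurable]: "(\<lambda>g. g d) \<in> gaussian (insert d J) \<rightarrow>\<^sub>M std_normal_distribution"
    by (rule measurable_component_singleton) simp
  show int: "integrable (gaussian (insert d J)) (\<lambda>g. u (g d) * f g)"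
  proof (rule integrableI_bounded)
    have "(\<integral>\<^sup>+ g. ennreal (norm (u (g d) * f g)) \<partial>gaussian (insert d J))
      = (\<integral>\<^sup>+ g. \<integral>\<^sup>+ x. ennreal (norm (f g)) * ennreal (norm (u x)) \<partial>std_normal_distribution \<partial>gaussian J)"
      by (subst gaussian.product_nn_integral_insert[OF J])
         (auto simp: f_upd abs_mult ennreal_mult' mult.commute)
    also have "\<dots> = (\<integral>\<^sup>+ g. ennreal (norm (f g)) \<partial>gaussian J) * (\<integral>\<^sup>+ x. ennreal (norm (u x)) \<partial>std_normal_distribution)"
    proof -
      have "(\<lambda>x. ennreal (norm (u x))) \<in> borel_measurable std_normal_distribution"
        "(\<lambda>g. ennreal (norm (f g))) \<in> borel_measurable (gaussian J)" by measurable
      then show ?thesis by (simp only: nn_integral_cmult nn_integral_multc)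
    qed
    also have "\<dots> < \<infinity>"
      using f u by (auto simp: integrable_iff_bounded intro!: ennreal_mult_less_top[THEN iffD2])
    finally show "(\<integral>\<^sup>+ g. ennreal (norm (u (g d) * f g)) \<partial>gaussian (insert d J)) < \<infinity>" .
  qed measurable
  show "(\<integral>g. u (g d) * f g \<partial>gaussian (insert d J))
      = (\<integral>x. u x \<partial>std_normal_distribution) * (\<integral>g. f g \<partial>gaussian J)"
    by (subst gaussian.product_integral_insert[OF J int]) (simp add: f_upd)
qed

text \<open>Against the Gaussian density the exponential becomes
  \<open>exp (- c * x\<^sup>2)\<close> up to a constant, a multiple of the normal density with
  variance \<open>1 / (2 * c)\<close>.\<close>

lemma integrable_std_normal_exp_square:
  assumes "0 < c" shows "integrable std_normal_distribution (\<lambda>x. exp ((1/2 - c) * x\<^sup>2))"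
proof -
  define \<sigma> where "\<sigma> = sqrt (1 / (2 * c))"
  have \<sigma>: "\<sigma> > 0" "\<sigma>\<^sup>2 = 1 / (2 * c)" using assms by (simp_all add: \<sigma>_def)
  have "std_normal_density x * exp ((1/2 - c) * x\<^sup>2) = \<sigma> * normal_density 0 \<sigma> x" for x
  proof -
    have "exp (- x\<^sup>2 / 2) * exp ((1/2 - c) * x\<^sup>2) = exp (- (x\<^sup>2) / (2 * \<sigma>\<^sup>2))"
      unfolding \<sigma>(2) exp_add[symmetric] using assms by (simp add: algebra_simps)
    then show ?thesis
      using \<sigma>(1) by (simp add: normal_density_def real_sqrt_mult)
  qed
  then show ?thesis using \<sigma>(1) by (subst integrable_std_normal_iff) auto
qed

lemma std_normal_Icc_pos: "0 < (\<integral>x. indicator {-1..1::real} x \<partial>std_normal_distribution :: real)"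
proof -
  have "emeasure std_normal_distribution {-1..1} \<noteq> 0"
  proof
    assume "emeasure std_normal_distribution {-1..1} = 0"
    then have "AE x in lborel. ennreal (std_normal_density x) * indicator {-1..1} x = 0"
      by (simp add: emeasure_density nn_integral_0_iff_AE)
    then have "AE x in lborel. x \<notin> {-1..1::real}"
    proof eventually_elim
      case (elim x)
      moreover have "0 < std_normal_density x" by (simp add: normal_density_pos)
      ultimately show ?case by (auto simp: indicator_def split: if_splits)
    qed
    then have "emeasure lborel {-1..1::real} = 0"
      by (subst (asm) AE_iff_measurable[of "{-1..1}"]) auto
    then show False by simp
  qed
  then show ?thesis
    by (simp add: std_normal.emeasure_eq_measure zero_less_measure_iff)
qed


text \<open>\<open>A1\<close> and \<open>A2\<close> are the pointwise constants, \<open>U\<close> is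
  the integral over the split-off coordinate, and \<open>C0\<close> is the price of returning from
  the reduced vector to the full one by restricting that coordinate to \<open>{-1..1}\<close>. The
  condition \<open>big\<close> makes the region where \<open>s / N\<close> is off by more than
  \<open>\<epsilon>\<close> carry at most half of the reduced mass.\<close>

lemma gibbs_weight_distance:
  fixes w :: "'i \<Rightarrow> real" and \<theta> v c \<delta> \<epsilon> a b :: real
  defines "A1 \<equiv> 2 / \<epsilon> + 1 / \<delta>"
    and "A2 \<equiv> 1 / \<epsilon> + (16 / c)\<^sup>2 * (1 + 2 * b) * (1 / \<delta> + \<bar>\<theta>\<bar>)"
    and "U \<equiv> \<integral>x. exp ((1/2 - c/8) * x\<^sup>2) \<partial>std_normal_distribution"
    and "C0 \<equiv> exp (2 * \<bar>\<theta>\<bar> * b) / (\<integral>x. indicator {-1..1::real} x \<partial>std_normal_distribution)"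
  assumes J: "finite J" "d \<notin> J" "2 \<le> card J" and I: "I = insert d J" and N: "N = real (card I)"
    and w: "\<forall>i\<in>I. w i \<in> {0..b}" and b: "0 \<le> b"
    and c: "0 < c" "c \<le> 1" "c \<le> 1 + 2 * \<theta> * (v - w d)"
    and \<epsilon>: "0 < \<epsilon>" "\<epsilon> \<le> 1/2" "2 * \<bar>\<theta>\<bar> * b * \<epsilon> \<le> c / 8" and \<delta>: "0 < \<delta>" "\<bar>\<theta>\<bar> * \<delta> \<le> c / 8"
    and big: "3 / sqrt N \<le> \<epsilon> / 2" and a: "0 \<le> a"
    and E1_def: "E1 = (\<lambda>g. exp (\<theta> * N * rayleigh w I g))"
    and E2_def: "E2 = (\<lambda>g. exp (\<theta> * N * rayleigh w J g) * exp (- \<theta> * (v - w d) * (g d)\<^sup>2))"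
    and conc: "(\<integral>g. (rayleigh w I g - v)\<^sup>2 * E1 g \<partial>gaussian I) \<le> a * (\<integral>g. E1 g \<partial>gaussian I)"
  shows "integrable (gaussian I) E2"
    and "(\<integral>g. \<bar>E1 g - E2 g\<bar> \<partial>gaussian I)
      \<le> (A1 * (2 + (3 + 2 * \<bar>\<theta>\<bar>) / c) + A2 * U * C0 * (9 + 2 * b))
          * (1 / sqrt N + sqrt a) * (\<integral>g. E1 g \<partial>gaussian I)"
proof -
  define s where "s = sqn J"
  define hb where "hb = rayleigh w J"
  define h where "h = rayleigh w I"
  define B where "B = (\<lambda>g. exp (\<theta> * N * hb g))"
  define good where "good = (\<lambda>g. \<bar>s g / N - 1\<bar> \<le> \<epsilon>)"
  define u where "u = (\<lambda>x::real. exp ((1/2 - c/8) * x\<^sup>2))"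
  define D where "D = (\<lambda>g. if good g then \<bar>hb g - v\<bar> else 0)"
  define X1 where "X1 = (\<lambda>g. \<bar>h g - v\<bar> + \<bar>sqn I g / N - 1\<bar> + (g d)\<^sup>2 / sqn I g)"
  define X2 where "X2 = (\<lambda>g. \<bar>s g / N - 1\<bar> + D g + 1 / N)"
  define Z where "Z = (\<integral>g. E1 g \<partial>gaussian I)"
  define W where "W = (\<integral>g. B g \<partial>gaussian J)"
  define r where "r = 1 / sqrt N"
  have finI: "finite I" and dI: "d \<in> I" and JI: "J \<subseteq> I" using I J by auto
  have card: "card I = card J + 1" using I J by simp
  have N3: "3 \<le> N" using N card J by simp
  then have N0: "0 < N" by simp
  have wJ: "\<forall>i\<in>J. w i \<in> {0..b}" and wd: "0 \<le> w d" "w d \<le> b" using w JI dI by auto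
  have r: "0 < r" "1 / N \<le> r" "sqrt (2 * N) / N \<le> 2 * r" "(1 + sqrt (2 * N)) / N \<le> 3 * r"
  proof -
    have sN: "1 \<le> sqrt N" "sqrt N * sqrt N = N" using N3 by auto
    show "0 < r" using N0 by (simp add: r_def)
    have 1: "1 / N = r * r" using sN(2) by (simp add: r_def)
    have "r \<le> 1" using sN(1) by (simp add: r_def)
    then show i: "1 / N \<le> r" unfolding 1 using \<open>0 < r\<close> by (simp add: mult_left_le)
    have "sqrt N / N = r" using sN by (simp add: r_def divide_simps)
    moreover have "sqrt (2 * N) \<le> 2 * sqrt N" 
      using N0 by (simp add: real_sqrt_mult sqrt_le_D real_le_lsqrt)
    ultimately show ii: "sqrt (2 * N) / N \<le> 2 * r" 
      using N0 by (metis divide_right_mono less_imp_le times_divide_eq_right)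
    show "(1 + sqrt (2 * N)) / N \<le> 3 * r" using i ii by (simp add: add_divide_distrib)
  qed
  have C0: "0 \<le> C0" using std_normal_Icc_pos by (simp add: C0_def)
  have U: "0 \<le> U" by (simp add: U_def)
  have A: "0 \<le> A1" "0 \<le> A2" using \<epsilon> \<delta> b by (auto simp: A1_def A2_def)
  have B0: "0 < B g" and E10: "0 < E1 g" for g by (auto simp: B_def E1_def)
  have hb_bounds: "0 \<le> hb g" "hb g \<le> b" for g using rayleigh_bounds[OF wJ b] by (auto simp: hb_def)
  have D_bounds: "0 \<le> D g" "D g \<le> b + \<bar>v\<bar>" for g using hb_bounds[of g] by (auto simp: D_def)
  have upd: "s (g(d := x)) = s g" "hb (g(d := x)) = hb g" for g x
    using J by (simp_all add: s_def hb_def sqn_fun_upd rayleigh_fun_upd)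
  have sqnI: "sqn I g = s g + (g d)\<^sup>2" for g using J by (simp add: I s_def sqn_insert)
  have hI: "h g = (hb g * s g + w d * (g d)\<^sup>2) / (s g + (g d)\<^sup>2)" for g
    using J by (simp add: h_def hb_def s_def I rayleigh_insert)
  have meas: "s \<in> borel_measurable (gaussian K)" "hb \<in> borel_measurable (gaussian K)" if "J \<subseteq> K" for K
    using that by (auto simp: s_def hb_def intro: measurable_sqn measurable_rayleigh)
  have meas_BD: "B \<in> borel_measurable (gaussian K)" "D \<in> borel_measurable (gaussian K)"
      "(\<lambda>g. if good g then 1 else 0 :: real) \<in> borel_measurable (gaussian K)" if "J \<subseteq> K" for K
  proof -
    note [measurable] = meas[OF that]
    show "B \<in> borel_measurable (gaussian K)" unfolding B_def by measurable
    show "D \<in> borel_measurable (gaussian K)" unfolding D_def good_def by measurable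
    show "(\<lambda>g. if good g then 1 else 0 :: real) \<in> borel_measurable (gaussian K)" unfolding good_def by measurable
  qed
  note [measurable] = meas[OF JI] meas[OF subset_refl] meas_BD[OF JI] meas_BD[OF subset_refl]
  have [measurable]: "h \<in> borel_measurable (gaussian I)" "sqn I \<in> borel_measurable (gaussian I)"
      "(\<lambda>g. g d) \<in> borel_measurable (gaussian I)"
    using dI by (auto simp: h_def intro: measurable_rayleigh measurable_sqn measurable_gaussian_coord)
  have [measurable]: "E1 \<in> borel_measurable (gaussian I)" "E2 \<in> borel_measurable (gaussian I)"
    unfolding E1_def E2_def h_def[symmetric] hb_def[symmetric] by measurable

  have int_B: "integrable (gaussian J) B"
    unfolding B_def hb_def by (rule exp_rayleigh_integrable[OF J(1) subset_refl wJ b])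
  have int_E1: "integrable (gaussian I) E1"
    unfolding E1_def by (rule exp_rayleigh_integrable[OF finI subset_refl w b])
  have int_u: "integrable std_normal_distribution u"
    unfolding u_def using integrable_std_normal_exp_square[of "c / 8"] c by simp
  have int_B_bdd: "integrable (gaussian J) (\<lambda>g. f g * B g)"
    if "f \<in> borel_measurable (gaussian J)" "\<And>g. \<bar>f g\<bar> \<le> K" for f K
  proof (rule Bochner_Integration.integrable_bound)
    show "integrable (gaussian J) (\<lambda>g. K * B g)" using int_B by simp
    show "AE g in gaussian J. norm (f g * B g) \<le> norm (K * B g)"
      using that(2) B0 by (intro AE_I2) (auto simp: abs_mult intro!: mult_right_mono order_trans[OF that(2) abs_ge_self])
  qed (use that(1) in measurable)

  have Z0: "0 \<le> Z" unfolding Z_def using E10 by (intro Bochner_Integration.integral_nonneg) (simp add: less_imp_le)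
  have W0: "0 \<le> W" unfolding W_def using B0 by (intro Bochner_Integration.integral_nonneg) (simp add: less_imp_le)

  have rad_s: "integrable (gaussian J) (\<lambda>g. \<bar>s g / N - 1\<bar> * B g)"
      "(\<integral>g. \<bar>s g / N - 1\<bar> * B g \<partial>gaussian J) \<le> 3 * r * W"
  proof -
    \<comment> \<open>The tilt is \<open>\<theta> * N\<close> although \<open>J\<close> has only
      \<open>N - 1\<close> elements; the radial estimate holds for every tilt. Centring at
      \<open>N\<close> instead of \<open>card J\<close> costs the extra term
      \<open>B g / N\<close>.\<close>
    note rd = radial_deviation[OF J(1,3) wJ b, of "\<theta> * N", folded s_def hb_def B_def, folded B_def]
    have int: "integrable (gaussian J) (\<lambda>g. \<bar>s g - card J\<bar> * B g)" using rd(1) by (simp add: B_def)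
    have le: "\<bar>s g / N - 1\<bar> * B g \<le> (\<bar>s g - card J\<bar> * B g + B g) / N" for g
    proof -
      have "\<bar>s g / N - 1\<bar> = \<bar>s g - N\<bar> / N" using N0 by (simp add: divide_simps)
      also have "\<dots> \<le> (\<bar>s g - card J\<bar> + 1) / N"
        using N card N0 by (intro divide_right_mono) auto
      finally have "\<bar>s g / N - 1\<bar> * B g \<le> (\<bar>s g - card J\<bar> + 1) / N * B g"
        using B0[of g] by (intro mult_right_mono) auto
      then show ?thesis by (simp add: distrib_right)
    qed
    show int': "integrable (gaussian J) (\<lambda>g. \<bar>s g / N - 1\<bar> * B g)"
    proof (rule Bochner_Integration.integrable_bound)
      show "integrable (gaussian J) (\<lambda>g. (\<bar>s g - card J\<bar> * B g + B g) / N)" using int int_B by simp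
      show "AE g in gaussian J. norm (\<bar>s g / N - 1\<bar> * B g) \<le> norm ((\<bar>s g - card J\<bar> * B g + B g) / N)"
      proof (rule AE_I2)
        fix g
        have "norm (\<bar>s g / N - 1\<bar> * B g) = \<bar>s g / N - 1\<bar> * B g"
          using B0[of g] by (simp add: abs_mult)
        also note le
        also have "(\<bar>s g - card J\<bar> * B g + B g) / N \<le> norm ((\<bar>s g - card J\<bar> * B g + B g) / N)"
          by (simp only: real_norm_def abs_ge_self)
        finally show "norm (\<bar>s g / N - 1\<bar> * B g) \<le> norm ((\<bar>s g - card J\<bar> * B g + B g) / N)" .
      qed
    qed measurable
    have "(\<integral>g. \<bar>s g / N - 1\<bar> * B g \<partial>gaussian J) \<le> (\<integral>g. (\<bar>s g - card J\<bar> * B g + B g) / N \<partial>gaussian J)"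
      using int int_B int' le by (intro integral_mono) auto
    also have "\<dots> = ((\<integral>g. \<bar>s g - card J\<bar> * B g \<partial>gaussian J) + W) / N"
      using int int_B by (simp add: W_def)
    also have "\<dots> \<le> (sqrt (2 * card J) * W + W) / N"
      using rd(2) N0 by (intro divide_right_mono add_right_mono) (auto simp: W_def B_def)
    also have "\<dots> \<le> (sqrt (2 * N) * W + W) / N"
      using N card N0 W0 by (intro divide_right_mono add_right_mono mult_right_mono) auto
    also have "\<dots> = (1 + sqrt (2 * N)) / N * W" by (simp add: algebra_simps)
    also have "\<dots> \<le> 3 * r * W" using r(4) W0 by (rule mult_right_mono)
    finally show "(\<integral>g. \<bar>s g / N - 1\<bar> * B g \<partial>gaussian J) \<le> 3 * r * W" .
  qed

  have card2: "2 \<le> card I" using J card by simp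
  have \<kappa>: "\<theta> * N = \<theta> * real (card I)" by (simp add: N)
  note cr = coord_ratio_integral_le[OF finI card2 dI w b c(3) a \<kappa> conc[unfolded E1_def]]
  have dev: "integrable (gaussian I) (\<lambda>g. \<bar>h g - v\<bar> * E1 g)"
      "(\<integral>g. \<bar>h g - v\<bar> * E1 g \<partial>gaussian I) \<le> sqrt a * Z"
    using cr(1,2) by (simp_all only: E1_def h_def Z_def)
  have ratio: "integrable (gaussian I) (\<lambda>g. (g d)\<^sup>2 / sqn I g * E1 g)"
      "(\<integral>g. (g d)\<^sup>2 / sqn I g * E1 g \<partial>gaussian I) \<le> (3 * r + 2 * \<bar>\<theta>\<bar> * sqrt a) / c * Z"
  proof -
    show "integrable (gaussian I) (\<lambda>g. (g d)\<^sup>2 / sqn I g * E1 g)" using cr(3) by (simp only: E1_def)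
    have "c * N * (\<integral>g. (g d)\<^sup>2 / sqn I g * E1 g \<partial>gaussian I)
        \<le> (1 + sqrt (2 * N) + 2 * \<bar>\<theta>\<bar> * N * sqrt a) * Z"
      using cr(4) by (simp only: E1_def Z_def N)
    then have "(\<integral>g. (g d)\<^sup>2 / sqn I g * E1 g \<partial>gaussian I)
        \<le> (1 + sqrt (2 * N) + 2 * \<bar>\<theta>\<bar> * N * sqrt a) * Z / (c * N)"
      using c N0 by (simp add: pos_le_divide_eq mult.commute)
    also have "\<dots> = ((1 + sqrt (2 * N)) / N + 2 * \<bar>\<theta>\<bar> * sqrt a) / c * Z"
      using N0 c by (simp add: field_simps)
    also have "\<dots> \<le> (3 * r + 2 * \<bar>\<theta>\<bar> * sqrt a) / c * Z"
      using r(4) c Z0 by (intro mult_right_mono divide_right_mono add_right_mono) auto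
    finally show "(\<integral>g. (g d)\<^sup>2 / sqn I g * E1 g \<partial>gaussian I) \<le> (3 * r + 2 * \<bar>\<theta>\<bar> * sqrt a) / c * Z" .
  qed
  have rad_Q: "integrable (gaussian I) (\<lambda>g. \<bar>sqn I g / N - 1\<bar> * E1 g)"
      "(\<integral>g. \<bar>sqn I g / N - 1\<bar> * E1 g \<partial>gaussian I) \<le> 2 * r * Z"
  proof -
    note rd = radial_deviation[OF finI card2 w b, of "\<theta> * N"]
    have int: "integrable (gaussian I) (\<lambda>g. \<bar>sqn I g - N\<bar> * E1 g)" using rd(1) by (simp only: E1_def N)
    have eq: "\<bar>sqn I g / N - 1\<bar> * E1 g = 1 / N * (\<bar>sqn I g - N\<bar> * E1 g)" for g
      using N0 by (simp add: divide_simps)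
    show "integrable (gaussian I) (\<lambda>g. \<bar>sqn I g / N - 1\<bar> * E1 g)" unfolding eq using int by simp
    have "(\<integral>g. \<bar>sqn I g / N - 1\<bar> * E1 g \<partial>gaussian I) = 1 / N * (\<integral>g. \<bar>sqn I g - N\<bar> * E1 g \<partial>gaussian I)"
      unfolding eq by (rule integral_mult_right_zero)
    also have "\<dots> \<le> 1 / N * (sqrt (2 * N) * Z)"
      using rd(2) N0 by (intro mult_left_mono) (simp_all only: E1_def N Z_def, simp)
    also have "\<dots> = sqrt (2 * N) / N * Z" by simp
    also have "\<dots> \<le> 2 * r * Z" using r(3) Z0 by (rule mult_right_mono)
    finally show "(\<integral>g. \<bar>sqn I g / N - 1\<bar> * E1 g \<partial>gaussian I) \<le> 2 * r * Z" .
  qed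
  have X1E1: "integrable (gaussian I) (\<lambda>g. X1 g * E1 g)"
      "(\<integral>g. X1 g * E1 g \<partial>gaussian I) \<le> (2 + (3 + 2 * \<bar>\<theta>\<bar>) / c) * (r + sqrt a) * Z"
  proof -
    have eq: "X1 g * E1 g = \<bar>h g - v\<bar> * E1 g + \<bar>sqn I g / N - 1\<bar> * E1 g + (g d)\<^sup>2 / sqn I g * E1 g" for g
      by (simp only: X1_def distrib_right)
    show "integrable (gaussian I) (\<lambda>g. X1 g * E1 g)"
      unfolding eq by (intro Bochner_Integration.integrable_add dev(1) rad_Q(1) ratio(1))
    have "(\<integral>g. X1 g * E1 g \<partial>gaussian I) = (\<integral>g. \<bar>h g - v\<bar> * E1 g \<partial>gaussian I)
        + (\<integral>g. \<bar>sqn I g / N - 1\<bar> * E1 g \<partial>gaussian I) + (\<integral>g. (g d)\<^sup>2 / sqn I g * E1 g \<partial>gaussian I)"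
      unfolding eq Bochner_Integration.integral_add[OF Bochner_Integration.integrable_add[OF dev(1) rad_Q(1)] ratio(1)]
        Bochner_Integration.integral_add[OF dev(1) rad_Q(1)] by (rule refl)
    also have "\<dots> \<le> sqrt a * Z + 2 * r * Z + (3 * r + 2 * \<bar>\<theta>\<bar> * sqrt a) / c * Z"
      by (intro add_mono dev(2) rad_Q(2) ratio(2))
    also have "\<dots> = (sqrt a + 2 * r + (3 * r + 2 * \<bar>\<theta>\<bar> * sqrt a) / c) * Z" by (simp only: distrib_right)
    also have "\<dots> \<le> (2 + (3 + 2 * \<bar>\<theta>\<bar>) / c) * (r + sqrt a) * Z"
    proof (rule mult_right_mono[OF _ Z0])
      have "(3 * r + 2 * \<bar>\<theta>\<bar> * sqrt a) / c \<le> (3 + 2 * \<bar>\<theta>\<bar>) * (r + sqrt a) / c"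
        using c r(1) a by (intro divide_right_mono) (auto simp: algebra_simps)
      moreover have "sqrt a + 2 * r \<le> 2 * (r + sqrt a)" using a by simp
      ultimately show "sqrt a + 2 * r + (3 * r + 2 * \<bar>\<theta>\<bar> * sqrt a) / c \<le> (2 + (3 + 2 * \<bar>\<theta>\<bar>) / c) * (r + sqrt a)"
        unfolding distrib_right[of 2] times_divide_eq_left by linarith
    qed
    finally show "(\<integral>g. X1 g * E1 g \<partial>gaussian I) \<le> (2 + (3 + 2 * \<bar>\<theta>\<bar>) / c) * (r + sqrt a) * Z" .
  qed

  \<comment> \<open>The truncation is essential: \<open>lower_pt\<close> bounds \<open>B\<close> by
    a multiple of \<open>E1\<close> only where \<open>s\<close> is at least
    \<open>N / 2\<close>.\<close>
  define G where "G = (\<lambda>g. (if good g then 1 else 0) * B g)"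
  have int_G: "integrable (gaussian J) G"
    unfolding G_def by (rule int_B_bdd[where K = 1]) auto
  have int_DB: "integrable (gaussian J) (\<lambda>g. D g * B g)"
    by (rule int_B_bdd[where K = "b + \<bar>v\<bar>"]) (use D_bounds in auto)
  \<comment> \<open>As \<open>F\<close> ignores the \<open>d\<close>-th coordinate, inserting the
    indicator multiplies its integral by the Gaussian mass of \<open>{-1..1}\<close>, which can be
    divided out again.\<close>
  have lower: "(\<integral>g. F g \<partial>gaussian J) \<le> C0 * y"
    if F: "integrable (gaussian J) F" "F \<in> borel_measurable (gaussian I)" "\<And>g x. F (g(d := x)) = F g"
      and H: "integrable (gaussian I) H" "(\<integral>g. H g \<partial>gaussian I) \<le> y"
      and le: "\<And>g. exp (- 2 * \<bar>\<theta>\<bar> * b) * (indicator {-1..1} (g d) * F g) \<le> H g" for F H y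
  proof -
    let ?P = "\<integral>x. indicator {-1..1::real} x \<partial>std_normal_distribution :: real"
    have int_ind: "integrable std_normal_distribution (indicator {-1..1::real} :: real \<Rightarrow> real)"
      by (rule std_normal.integrable_const_bound[where B = 1]) auto
    note split = gaussian_insert_product[OF J(1,2) F(1) F(2)[unfolded I] F(3) int_ind, folded I]
    have "exp (- 2 * \<bar>\<theta>\<bar> * b) * (?P * (\<integral>g. F g \<partial>gaussian J))
        = (\<integral>g. exp (- 2 * \<bar>\<theta>\<bar> * b) * (indicator {-1..1} (g d) * F g) \<partial>gaussian I)"
      unfolding split(2)[symmetric] by (rule integral_mult_right_zero[symmetric])
    also have "\<dots> \<le> (\<integral>g. H g \<partial>gaussian I)"
      using split(1) H(1) le by (intro integral_mono integrable_mult_right)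
    also have "\<dots> \<le> y" by (rule H(2))
    finally have "exp (2 * \<bar>\<theta>\<bar> * b) / ?P * (exp (- 2 * \<bar>\<theta>\<bar> * b) * (?P * (\<integral>g. F g \<partial>gaussian J))) \<le> C0 * y"
      unfolding C0_def using std_normal_Icc_pos by (intro mult_left_mono) auto
    moreover have cancel: "exp (2 * \<bar>\<theta>\<bar> * b) / p * (exp (- 2 * \<bar>\<theta>\<bar> * b) * (p * q)) = q" if "0 < p" for p q :: real
    proof -
      have "exp (- 2 * \<bar>\<theta>\<bar> * b) = 1 / exp (2 * \<bar>\<theta>\<bar> * b)" by (simp add: exp_minus inverse_eq_divide)
      then show ?thesis using that by simp
    qed
    ultimately show ?thesis by (simp only: cancel[OF std_normal_Icc_pos])
  qed
  have lower_pt: "exp (- 2 * \<bar>\<theta>\<bar> * b) * B g \<le> E1 g" "\<bar>hb g - v\<bar> \<le> \<bar>h g - v\<bar> + 2 * b / N"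
    if "good g" "\<bar>g d\<bar> \<le> 1" for g
  proof -
    have "(g d)\<^sup>2 \<le> 1" using that(2) by (simp add: abs_square_le_1)
    note pt = pointwise_lower_comparison[OF that(1)[unfolded good_def] zero_le_power2 this hb_bounds[of g] wd N0 \<epsilon>(2)
        hI[of g]]
    show "exp (- 2 * \<bar>\<theta>\<bar> * b) * B g \<le> E1 g"
      using pt(1)[of \<theta>] by (simp only: B_def E1_def h_def)
    show "\<bar>hb g - v\<bar> \<le> \<bar>h g - v\<bar> + 2 * b / N" by (rule pt(2))
  qed
  have G_le: "(\<integral>g. G g \<partial>gaussian J) \<le> C0 * Z"
  proof (rule lower[OF int_G _ _ int_E1])
    show "G \<in> borel_measurable (gaussian I)" unfolding G_def by measurable
    show "exp (- 2 * \<bar>\<theta>\<bar> * b) * (indicator {-1..1} (g d) * G g) \<le> E1 g" for g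
      using lower_pt(1)[of g] E10[of g] by (auto simp: G_def indicator_def)
  qed (simp_all add: Z_def G_def good_def B_def upd)
  have DB_le: "(\<integral>g. D g * B g \<partial>gaussian J) \<le> C0 * ((sqrt a + 2 * b * r) * Z)"
  proof (rule lower[OF int_DB])
    show "(\<lambda>g. D g * B g) \<in> borel_measurable (gaussian I)" by measurable
    show int: "integrable (gaussian I) (\<lambda>g. \<bar>h g - v\<bar> * E1 g + 2 * b / N * E1 g)"
      using dev(1) int_E1 by simp
    have "(\<integral>g. \<bar>h g - v\<bar> * E1 g + 2 * b / N * E1 g \<partial>gaussian I)
        = (\<integral>g. \<bar>h g - v\<bar> * E1 g \<partial>gaussian I) + 2 * b * (1 / N) * Z"
      using dev(1) int_E1 by (simp add: Z_def)
    also have "\<dots> \<le> sqrt a * Z + 2 * b * r * Z"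
      using dev(2) r(2) b Z0 by (intro add_mono mult_right_mono mult_left_mono) auto
    finally show "(\<integral>g. \<bar>h g - v\<bar> * E1 g + 2 * b / N * E1 g \<partial>gaussian I) \<le> (sqrt a + 2 * b * r) * Z"
      by (simp add: distrib_right)
    show "exp (- 2 * \<bar>\<theta>\<bar> * b) * (indicator {-1..1} (g d) * (D g * B g)) \<le> \<bar>h g - v\<bar> * E1 g + 2 * b / N * E1 g" for g
    proof (cases "good g \<and> \<bar>g d\<bar> \<le> 1")
      case True
      have "\<bar>hb g - v\<bar> * (exp (- 2 * \<bar>\<theta>\<bar> * b) * B g) \<le> (\<bar>h g - v\<bar> + 2 * b / N) * E1 g"
        using lower_pt[of g] True B0[of g] b N0 by (intro mult_mono) auto
      then show ?thesis using True by (simp add: D_def indicator_def distrib_right distrib_left mult_ac abs_le_iff)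
    next
      case False
      then have "exp (- 2 * \<bar>\<theta>\<bar> * b) * (indicator {-1..1} (g d) * (D g * B g)) = 0"
        by (auto simp: D_def indicator_def abs_le_iff)
      also have "0 \<le> \<bar>h g - v\<bar> * E1 g + 2 * b / N * E1 g"
        using b N0 E10[of g] by (intro add_nonneg_nonneg mult_nonneg_nonneg) auto
      finally show ?thesis .
    qed
  qed (simp add: D_def good_def B_def upd)
  \<comment> \<open>Self-absorption: outside \<open>good\<close>, \<open>B\<close> is at most
    \<open>\<bar>s g / N - 1\<bar> / \<epsilon>\<close> times itself, and the resulting integral is
    at most \<open>W / 2\<close> by \<open>rad_s\<close> and \<open>big\<close>. The finite
    \<open>W / 2\<close> moves to the left.\<close>
  have W_le: "W \<le> 2 * C0 * Z"
  proof -
    have "W \<le> (\<integral>g. G g + 1 / \<epsilon> * (\<bar>s g / N - 1\<bar> * B g) \<partial>gaussian J)"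
      unfolding W_def
    proof (intro integral_mono int_B Bochner_Integration.integrable_add int_G integrable_mult_right rad_s(1))
      fix g
      show "B g \<le> G g + 1 / \<epsilon> * (\<bar>s g / N - 1\<bar> * B g)"
      proof (cases "good g")
        case True
        then show ?thesis using B0[of g] \<epsilon> by (simp add: G_def)
      next
        case False
        then have "1 \<le> 1 / \<epsilon> * \<bar>s g / N - 1\<bar>" using \<epsilon> by (simp add: good_def divide_simps)
        then have "1 * B g \<le> 1 / \<epsilon> * \<bar>s g / N - 1\<bar> * B g" using B0[of g] by (intro mult_right_mono) auto
        then show ?thesis using False by (simp add: G_def)
      qed
    qed
    also have "\<dots> = (\<integral>g. G g \<partial>gaussian J) + 1 / \<epsilon> * (\<integral>g. \<bar>s g / N - 1\<bar> * B g \<partial>gaussian J)"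
      using int_G rad_s(1) by simp
    also have "\<dots> \<le> C0 * Z + 1 / \<epsilon> * (\<epsilon> / 2 * W)"
    proof (intro add_mono G_le mult_left_mono)
      have "3 * r * W \<le> \<epsilon> / 2 * W" using big W0 by (intro mult_right_mono) (auto simp: r_def)
      then show "(\<integral>g. \<bar>s g / N - 1\<bar> * B g \<partial>gaussian J) \<le> \<epsilon> / 2 * W" using rad_s(2) by simp
    qed (use \<epsilon> in auto)
    also have "\<dots> = C0 * Z + W / 2" using \<epsilon> by simp
    finally show ?thesis by simp
  qed
  have X2B: "integrable (gaussian J) (\<lambda>g. X2 g * B g)"
      "(\<integral>g. X2 g * B g \<partial>gaussian J) \<le> C0 * (9 + 2 * b) * (r + sqrt a) * Z"
  proof -
    have eq: "X2 g * B g = \<bar>s g / N - 1\<bar> * B g + D g * B g + 1 / N * B g" for g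
      by (simp only: X2_def distrib_right)
    show "integrable (gaussian J) (\<lambda>g. X2 g * B g)"
      unfolding eq by (intro Bochner_Integration.integrable_add rad_s(1) int_DB integrable_mult_right int_B)
    have "(\<integral>g. X2 g * B g \<partial>gaussian J) = (\<integral>g. \<bar>s g / N - 1\<bar> * B g \<partial>gaussian J)
        + (\<integral>g. D g * B g \<partial>gaussian J) + 1 / N * W"
      unfolding eq W_def using rad_s(1) int_DB int_B by simp
    also have "\<dots> \<le> 3 * r * W + C0 * ((sqrt a + 2 * b * r) * Z) + r * W"
      using r(2) W0 by (intro add_mono rad_s(2) DB_le mult_right_mono)
    also have "\<dots> = 4 * r * W + C0 * ((sqrt a + 2 * b * r) * Z)" by (simp add: algebra_simps)
    also have "\<dots> \<le> 4 * r * (2 * C0 * Z) + C0 * ((sqrt a + 2 * b * r) * Z)"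
      using W_le r(1) by (intro add_right_mono mult_left_mono) auto
    also have "\<dots> = C0 * ((8 + 2 * b) * r + sqrt a) * Z" by (simp add: algebra_simps)
    also have "\<dots> \<le> C0 * ((9 + 2 * b) * (r + sqrt a)) * Z"
    proof (intro mult_right_mono mult_left_mono Z0 C0)
      have "0 \<le> r + 8 * sqrt a + 2 * (b * sqrt a)" using r(1) a b by simp
      then show "(8 + 2 * b) * r + sqrt a \<le> (9 + 2 * b) * (r + sqrt a)" by (simp add: algebra_simps)
    qed
    finally show "(\<integral>g. X2 g * B g \<partial>gaussian J) \<le> C0 * (9 + 2 * b) * (r + sqrt a) * Z"
      by (simp add: mult.assoc)
  qed
  have X2B_I: "integrable (gaussian I) (\<lambda>g. u (g d) * (X2 g * B g))"
      "(\<integral>g. u (g d) * (X2 g * B g) \<partial>gaussian I) = U * (\<integral>g. X2 g * B g \<partial>gaussian J)"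
  proof -
    have m: "(\<lambda>g. X2 g * B g) \<in> borel_measurable (gaussian (insert d J))"
      unfolding I[symmetric] X2_def by measurable
    have inv: "X2 (g(d := x)) * B (g(d := x)) = X2 g * B g" for g x
      by (simp add: X2_def D_def good_def B_def upd)
    from gaussian_insert_product[OF J(1,2) X2B(1) m inv int_u]
    show "integrable (gaussian I) (\<lambda>g. u (g d) * (X2 g * B g))"
      "(\<integral>g. u (g d) * (X2 g * B g) \<partial>gaussian I) = U * (\<integral>g. X2 g * B g \<partial>gaussian J)"
      by (simp_all only: I U_def u_def)
  qed
  show int_E2: "integrable (gaussian I) E2"
  proof -
    have "0 < (1 + 2 * \<theta> * (v - w d)) / 2" using c by simp
    from integrable_std_normal_exp_square[OF this]
    have int: "integrable std_normal_distribution (\<lambda>x. exp (- \<theta> * (v - w d) * x\<^sup>2))"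
      by (simp add: add_divide_distrib)
    have "B \<in> borel_measurable (gaussian (insert d J))" unfolding I[symmetric] by measurable
    from gaussian_insert_product(1)[OF J(1,2) int_B this _ int]
    have "integrable (gaussian I) (\<lambda>g. exp (- \<theta> * (v - w d) * (g d)\<^sup>2) * B g)"
      unfolding I by (simp add: B_def upd)
    then show ?thesis unfolding E2_def B_def hb_def by (simp only: mult.commute)
  qed
  have "J \<noteq> {}" using J by auto
  have AE: "AE g in gaussian I. \<bar>E1 g - E2 g\<bar> \<le> A1 * (X1 g * E1 g) + A2 * (u (g d) * (X2 g * B g))"
    using AE_sqn_pos[OF J(1) \<open>J \<noteq> {}\<close> JI]
  proof eventually_elim
    case (elim g)
    then have "0 < s g" by (simp add: s_def)
    from pointwise_comparison[OF this zero_le_power2 hb_bounds[of g] wd N0 c \<epsilon> \<delta> hI[of g] refl refl refl refl refl refl refl]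
    show ?case
      by (simp only: A1_def A2_def E1_def E2_def B_def hb_def h_def X1_def X2_def D_def good_def u_def sqnI)
  qed
  have "(\<integral>g. \<bar>E1 g - E2 g\<bar> \<partial>gaussian I) \<le> (\<integral>g. A1 * (X1 g * E1 g) + A2 * (u (g d) * (X2 g * B g)) \<partial>gaussian I)"
    using AE int_E1 int_E2 X1E1(1) X2B_I(1)
    by (intro integral_mono_AE integrable_abs Bochner_Integration.integrable_diff
        Bochner_Integration.integrable_add integrable_mult_right)
  also have "\<dots> = A1 * (\<integral>g. X1 g * E1 g \<partial>gaussian I) + A2 * (U * (\<integral>g. X2 g * B g \<partial>gaussian J))"
    using X1E1(1) X2B_I by simp
  also have "\<dots> \<le> A1 * ((2 + (3 + 2 * \<bar>\<theta>\<bar>) / c) * (r + sqrt a) * Z)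
      + A2 * (U * (C0 * (9 + 2 * b) * (r + sqrt a) * Z))"
    by (intro add_mono mult_left_mono X1E1(2) X2B(2) A U)
  also have "\<dots> = (A1 * (2 + (3 + 2 * \<bar>\<theta>\<bar>) / c) + A2 * U * C0 * (9 + 2 * b)) * (r + sqrt a) * Z"
    by (simp add: algebra_simps)
  finally show "(\<integral>g. \<bar>E1 g - E2 g\<bar> \<partial>gaussian I)
      \<le> (A1 * (2 + (3 + 2 * \<bar>\<theta>\<bar>) / c) + A2 * U * C0 * (9 + 2 * b))
          * (1 / sqrt N + sqrt a) * (\<integral>g. E1 g \<partial>gaussian I)"
    by (simp only: r_def Z_def)
qed

subsection \<open>Comparison of the Gibbs means\<close>

text \<open>The factor 2 counts the change of the numerator and that of the normalisation. Bounding
  \<open>p2 / Z2\<close> by \<open>F\<close> as a whole avoids any lower bound on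
  \<open>Z2\<close>.\<close>

lemma quotient_diff_le:
  fixes p1 p2 Z1 Z2 F \<Delta> :: real
  assumes "0 < Z1" "0 \<le> F" "\<bar>p1 - p2\<bar> \<le> F * \<Delta>" "\<bar>Z1 - Z2\<bar> \<le> \<Delta>" "0 \<le> Z2" "\<bar>p2\<bar> \<le> F * Z2"
  shows "\<bar>p1 / Z1 - p2 / Z2\<bar> \<le> 2 * F * (\<Delta> / Z1)"
proof -
  have eq: "p1 / Z1 - p2 / Z2 = (p1 - p2) / Z1 + p2 / Z2 * ((Z2 - Z1) / Z1)"
  proof (cases "Z2 = 0")
    \<comment> \<open>Here the last hypothesis forces \<open>p2 = 0\<close>, and the identity holds
      with division by zero equal to 0.\<close>
    case True
    then show ?thesis using assms(6) by (simp add: diff_divide_distrib)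
  next
    case False
    then show ?thesis using assms(1) by (simp add: field_simps)
  qed
  have "\<bar>(p1 - p2) / Z1\<bar> \<le> F * \<Delta> / Z1"
    using assms(1,3) by (simp add: divide_right_mono)
  moreover have "\<bar>p2 / Z2 * ((Z2 - Z1) / Z1)\<bar> \<le> F * (\<Delta> / Z1)"
    unfolding abs_mult
  proof (intro mult_mono)
    show "\<bar>p2 / Z2\<bar> \<le> F"
      using assms(2,5,6) by (cases "Z2 = 0") (auto simp: divide_le_eq)
    show "\<bar>(Z2 - Z1) / Z1\<bar> \<le> \<Delta> / Z1"
      using assms(1,4) by (simp add: abs_minus_commute divide_right_mono)
  qed (use assms in auto)
  ultimately have "\<bar>(p1 - p2) / Z1 + p2 / Z2 * ((Z2 - Z1) / Z1)\<bar> \<le> F * \<Delta> / Z1 + F * (\<Delta> / Z1)"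
    by (rule order_trans[OF abs_triangle_ineq add_mono])
  then show ?thesis unfolding eq by simp
qed

text \<open>The third bound also covers weights that are not integrable: the denominator is then 0
  by convention, and so is the quotient. This provides the trivial estimate for small
  \<open>N\<close>.\<close>

lemma weighted_mean_abs_le:
  fixes f e :: "'a \<Rightarrow> real"
  assumes f: "f \<in> borel_measurable M" "\<And>x. x \<in> space M \<Longrightarrow> \<bar>f x\<bar> \<le> F" and F: "0 \<le> F"
    and e: "\<And>x. 0 \<le> e x"
  shows "integrable M e \<Longrightarrow> integrable M (\<lambda>x. f x * e x)"
    and "integrable M e \<Longrightarrow> \<bar>\<integral>x. f x * e x \<partial>M\<bar> \<le> F * (\<integral>x. e x \<partial>M)"
    and "\<bar>(\<integral>x. f x * e x \<partial>M) / (\<integral>x. e x \<partial>M)\<bar> \<le> F"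
proof -
  have pt: "\<bar>f x * e x\<bar> \<le> F * e x" if "x \<in> space M" for x
    using f(2)[OF that] e[of x] by (simp add: abs_mult mult_right_mono)
  show int: "integrable M (\<lambda>x. f x * e x)" if "integrable M e"
  proof (rule Bochner_Integration.integrable_bound)
    show "integrable M (\<lambda>x. F * e x)" using that by simp
    show "(\<lambda>x. f x * e x) \<in> borel_measurable M" using f(1) that by auto
    show "AE x in M. norm (f x * e x) \<le> norm (F * e x)"
      using pt unfolding real_norm_def by (intro AE_I2 order_trans[OF _ abs_ge_self])
  qed
  show le: "\<bar>\<integral>x. f x * e x \<partial>M\<bar> \<le> F * (\<integral>x. e x \<partial>M)" if "integrable M e"
  proof -
    have "\<bar>\<integral>x. f x * e x \<partial>M\<bar> \<le> (\<integral>x. \<bar>f x * e x\<bar> \<partial>M)" by (rule integral_abs_bound)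
    also have "\<dots> \<le> (\<integral>x. F * e x \<partial>M)"
      using int[OF that] that pt by (intro integral_mono integrable_abs integrable_mult_right)
    finally show ?thesis by simp
  qed
  show "\<bar>(\<integral>x. f x * e x \<partial>M) / (\<integral>x. e x \<partial>M)\<bar> \<le> F"
  proof (cases "integrable M e")
    case True
    have "0 \<le> (\<integral>x. e x \<partial>M)" using e by simp
    then show ?thesis using le[OF True] F by (cases "(\<integral>x. e x \<partial>M) = 0") (auto simp: divide_le_eq)
  qed (use F in \<open>simp add: not_integrable_integral_eq\<close>)
qed

lemma weighted_mean_diff_le:
  fixes f e1 e2 :: "'a \<Rightarrow> real"
  assumes f: "f \<in> borel_measurable M" "\<And>x. x \<in> space M \<Longrightarrow> \<bar>f x\<bar> \<le> F" and F: "0 \<le> F"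
    and e: "integrable M e1" "integrable M e2" "\<And>x. 0 \<le> e1 x" "\<And>x. 0 \<le> e2 x"
    and Z: "0 < (\<integral>x. e1 x \<partial>M)"
  shows "\<bar>(\<integral>x. f x * e1 x \<partial>M) / (\<integral>x. e1 x \<partial>M) - (\<integral>x. f x * e2 x \<partial>M) / (\<integral>x. e2 x \<partial>M)\<bar>
    \<le> 2 * F * ((\<integral>x. \<bar>e1 x - e2 x\<bar> \<partial>M) / (\<integral>x. e1 x \<partial>M))"
proof (rule quotient_diff_le[OF Z F])
  note i1 = weighted_mean_abs_le(1)[OF f F e(3) e(1)] and i2 = weighted_mean_abs_le(1)[OF f F e(4) e(2)]
  have "\<bar>(\<integral>x. f x * e1 x \<partial>M) - (\<integral>x. f x * e2 x \<partial>M)\<bar> = \<bar>\<integral>x. f x * e1 x - f x * e2 x \<partial>M\<bar>"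
    using i1 i2 by simp
  also have "\<dots> \<le> (\<integral>x. \<bar>f x * e1 x - f x * e2 x\<bar> \<partial>M)" by (rule integral_abs_bound)
  also have "\<dots> \<le> (\<integral>x. F * \<bar>e1 x - e2 x\<bar> \<partial>M)"
  proof (intro integral_mono integrable_abs integrable_mult_right Bochner_Integration.integrable_diff i1 i2 e(1,2))
    fix x assume "x \<in> space M"
    then show "\<bar>f x * e1 x - f x * e2 x\<bar> \<le> F * \<bar>e1 x - e2 x\<bar>"
      using f(2) unfolding right_diff_distrib[symmetric] abs_mult by (intro mult_right_mono) auto
  qed
  finally show "\<bar>(\<integral>x. f x * e1 x \<partial>M) - (\<integral>x. f x * e2 x \<partial>M)\<bar> \<le> F * (\<integral>x. \<bar>e1 x - e2 x\<bar> \<partial>M)" by simp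
  have "(\<integral>x. e1 x \<partial>M) - (\<integral>x. e2 x \<partial>M) = (\<integral>x. e1 x - e2 x \<partial>M)" using e by simp
  then show "\<bar>(\<integral>x. e1 x \<partial>M) - (\<integral>x. e2 x \<partial>M)\<bar> \<le> (\<integral>x. \<bar>e1 x - e2 x\<bar> \<partial>M)"
    by (simp only: integral_abs_bound)
  show "0 \<le> (\<integral>x. e2 x \<partial>M)" using e(4) by simp
  show "\<bar>\<integral>x. f x * e2 x \<partial>M\<bar> \<le> F * (\<integral>x. e2 x \<partial>M)" by (rule weighted_mean_abs_le(2)[OF f F e(4) e(2)])
qed

section \<open>The Hamiltonians as Rayleigh quotients, and the final estimate\<close>

lemma gauss_eq: "gauss N = gaussian {1..N}"
  by (simp add: gauss_def)

lemma hamiltonian_eq: "hamiltonian \<gamma> N g = real N * rayleigh (\<gamma> N) {1..N} g"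
  by (simp add: hamiltonian_def rayleigh_def sqn_def L2_set_def sum_nonneg sum_divide_distrib)

lemma h_density_eq: "1 \<le> N \<Longrightarrow> h_density \<gamma> N g = rayleigh (\<gamma> N) {1..N} g"
  by (simp add: h_density_def hamiltonian_eq)

lemma decoupled_hamiltonian_eq:
  "decoupled_hamiltonian \<gamma> b \<rho> N \<theta> d g
    = real N * rayleigh (\<gamma> N) ({1..N} - {d}) g - (v_lim b \<rho> \<theta> - \<gamma> N d) * (g d)\<^sup>2"
  by (simp add: decoupled_hamiltonian_def rayleigh_def sqn_def L2_set_def sum_nonneg sum_divide_distrib)

lemma abs_le_sup_norm:
  assumes "bounded (f ` space (RN N))" "g \<in> space (RN N)" shows "\<bar>f g\<bar> \<le> sup_norm N f"
proof -
  obtain C where "\<forall>g\<in>space (RN N). \<bar>f g\<bar> \<le> C" using assms(1) by (auto simp: bounded_iff)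
  then have "bdd_above ((\<lambda>g. \<bar>f g\<bar>) ` space (RN N))" by (intro bdd_aboveI2) auto
  then show ?thesis unfolding sup_norm_def by (intro cSUP_upper assms(2))
qed

theorem theorem3p1:
  fixes \<gamma> :: "nat \<Rightarrow> nat \<Rightarrow> real" and b :: real and \<rho> :: "real measure" and \<theta> :: real
  assumes "b > 0"
    and "\<And>N i. N \<ge> 1 \<Longrightarrow> i \<in> {1..N} \<Longrightarrow> \<gamma> N i \<in> {0..b}"
    and "prob_space \<rho>" and "sets \<rho> = sets borel" and "measure \<rho> {0..b} = 1"
    and "(\<lambda>N. wasserstein1 (empirical_measure \<gamma> N) \<rho>) \<longlonglongrightarrow> 0"
    and "\<theta> \<in> T_set b \<rho>"
  shows "\<exists>K>0. \<forall>d\<ge>1. \<forall>N\<ge>d. \<forall>f.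
           f \<in> borel_measurable (RN N) \<longrightarrow> bounded (f ` space (RN N)) \<longrightarrow>
             \<bar>gibbs_mean N (hamiltonian \<gamma> N) \<theta> f
                - gibbs_mean N (decoupled_hamiltonian \<gamma> b \<rho> N \<theta> d) \<theta> f\<bar>
               \<le> K * sup_norm N f * a_tilde \<gamma> b \<rho> N \<theta>"
proof -
  interpret supported_law \<rho> b
    using assms by (intro supported_law.intro supported_law_axioms.intro)
  define v where "v = v_lim b \<rho> \<theta>"
  have \<theta>: "\<theta> \<noteq> 0" using assms(7) by (simp add: T_set_def)
  obtain c0 where c0: "c0 > 0" "\<And>w. w \<in> {0..b} \<Longrightarrow> c0 \<le> 1 + 2 * \<theta> * (v - w)"
    using precision_bounded_below[OF assms(7)] unfolding v_def by blast
  \<comment> \<open>The bound is uniform over all \<open>w\<close> in \<open>{0..b}\<close>, so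
    every constant below is independent of \<open>N\<close> and \<open>d\<close>. The cap at 1 is
    for \<open>poly_exp_le\<close>.\<close>
  define c where "c = min c0 1"
  have c: "0 < c" "c \<le> 1" "\<And>w. w \<in> {0..b} \<Longrightarrow> c \<le> 1 + 2 * \<theta> * (v - w)"
    using c0 by (auto simp: c_def min.coboundedI1)
  \<comment> \<open>\<open>\<delta>\<close> and \<open>\<epsilon>\<close> are chosen so that each
    exponent error in \<open>pointwise_comparison\<close> is at most \<open>c / 8\<close>; the cap
    at \<open>1/2\<close> on \<open>\<epsilon>\<close> keeps \<open>s\<close> above
    \<open>N / 2\<close>.\<close>
  define \<delta> where "\<delta> = c / (8 * \<bar>\<theta>\<bar>)"
  define \<epsilon> where "\<epsilon> = min (1/2) (c / (16 * \<bar>\<theta>\<bar> * b))"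
  have \<delta>: "0 < \<delta>" "\<bar>\<theta>\<bar> * \<delta> \<le> c / 8" using c \<theta> by (auto simp: \<delta>_def)
  have \<epsilon>: "0 < \<epsilon>" "\<epsilon> \<le> 1/2" "2 * \<bar>\<theta>\<bar> * b * \<epsilon> \<le> c / 8"
  proof -
    show "0 < \<epsilon>" "\<epsilon> \<le> 1/2" using c \<theta> assms(1) by (auto simp: \<epsilon>_def)
    have "2 * \<bar>\<theta>\<bar> * b * \<epsilon> \<le> 2 * \<bar>\<theta>\<bar> * b * (c / (16 * \<bar>\<theta>\<bar> * b))"
      using assms(1) by (intro mult_left_mono) (auto simp: \<epsilon>_def)
    then show "2 * \<bar>\<theta>\<bar> * b * \<epsilon> \<le> c / 8" using \<theta> assms(1) by simp
  qed
  define C where "C = (2 / \<epsilon> + 1 / \<delta>) * (2 + (3 + 2 * \<bar>\<theta>\<bar>) / c)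
    + (1 / \<epsilon> + (16 / c)\<^sup>2 * (1 + 2 * b) * (1 / \<delta> + \<bar>\<theta>\<bar>))
      * (\<integral>x. exp ((1/2 - c/8) * x\<^sup>2) \<partial>std_normal_distribution)
      * (exp (2 * \<bar>\<theta>\<bar> * b) / (\<integral>x. indicator {-1..1::real} x \<partial>std_normal_distribution)) * (9 + 2 * b)"
  have C: "0 \<le> C"
    unfolding C_def using \<epsilon> \<delta> c assms(1) std_normal_Icc_pos
    by (intro add_nonneg_nonneg mult_nonneg_nonneg divide_nonneg_pos) (auto intro: Bochner_Integration.integral_nonneg)
  \<comment> \<open>\<open>C\<close> serves large \<open>N\<close>, and
    \<open>6 / \<epsilon> + 2\<close> bounds \<open>sqrt N\<close> in the remaining cases; the 2 in
    front comes from comparing two normalised means.\<close>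
  define K where "K = 2 * (C + 6 / \<epsilon> + 2)"
  have "0 < K" using C \<epsilon> by (auto simp: K_def intro!: add_nonneg_pos)
  moreover have "\<bar>gibbs_mean N (hamiltonian \<gamma> N) \<theta> f
                - gibbs_mean N (decoupled_hamiltonian \<gamma> b \<rho> N \<theta> d) \<theta> f\<bar>
               \<le> K * sup_norm N f * a_tilde \<gamma> b \<rho> N \<theta>"
    if dN: "1 \<le> d" "d \<le> N" and f: "f \<in> borel_measurable (RN N)" "bounded (f ` space (RN N))" for d N f
  proof -
    let ?I = "{1..N}" and ?J = "{1..N} - {d}" and ?F = "sup_norm N f"
    define E1 where "E1 = (\<lambda>g. exp (\<theta> * real N * rayleigh (\<gamma> N) ?I g))"
    define E2 where "E2 = (\<lambda>g. exp (\<theta> * real N * rayleigh (\<gamma> N) ?J g) * exp (- \<theta> * (v - \<gamma> N d) * (g d)\<^sup>2))"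
    define Z where "Z = (\<integral>g. E1 g \<partial>gaussian ?I)"
    define a where "a = a_rate \<gamma> b \<rho> N \<theta>"
    have N: "1 \<le> N" using dN by simp
    have b: "0 \<le> b" using assms(1) by simp
    have w: "\<forall>i\<in>?I. \<gamma> N i \<in> {0..b}" using assms(2)[OF N] by blast
    have "space (gaussian ?I) = space (RN N)" by (simp add: space_PiM)
    then have fF: "\<bar>f g\<bar> \<le> ?F" if "g \<in> space (gaussian ?I)" for g
      using abs_le_sup_norm[OF f(2)] that by simp
    have fm: "f \<in> borel_measurable (gaussian ?I)"
      using f(1) measurable_cong_sets[OF sets_gaussian refl] by blast
    have F: "0 \<le> ?F"
      using fF[of "\<lambda>i\<in>?I. 0"] by (auto simp: space_PiM intro: order_trans[OF abs_ge_zero])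
    have e1: "exp (\<theta> * hamiltonian \<gamma> N g) = E1 g" for g
      by (simp add: E1_def hamiltonian_eq mult.assoc)
    have e2: "exp (\<theta> * decoupled_hamiltonian \<gamma> b \<rho> N \<theta> d g) = E2 g" for g
      by (simp add: E2_def decoupled_hamiltonian_eq v_def exp_add[symmetric] algebra_simps)
    have m1: "gibbs_mean N (hamiltonian \<gamma> N) \<theta> k = (\<integral>g. k g * E1 g \<partial>gaussian ?I) / Z" for k
      by (simp add: gibbs_mean_def gauss_eq e1 Z_def)
    have m2: "gibbs_mean N (decoupled_hamiltonian \<gamma> b \<rho> N \<theta> d) \<theta> f
        = (\<integral>g. f g * E2 g \<partial>gaussian ?I) / (\<integral>g. E2 g \<partial>gaussian ?I)"
      by (simp add: gibbs_mean_def gauss_eq e2)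
    have E0: "0 \<le> E1 g" "0 \<le> E2 g" for g by (simp_all add: E1_def E2_def)
    have int1: "integrable (gaussian ?I) E1"
      unfolding E1_def by (rule exp_rayleigh_integrable[OF _ subset_refl w b]) simp
    have Z: "0 < Z"
      unfolding Z_def E1_def by (rule integral_exp_rayleigh_pos[OF _ subset_refl w b]) simp
    have rate: "a = (\<integral>g. (rayleigh (\<gamma> N) ?I g - v)\<^sup>2 * E1 g \<partial>gaussian ?I) / Z"
      unfolding a_def a_rate_def m1 by (simp add: h_density_eq[OF N] v_def)
    have a: "0 \<le> a"
      unfolding rate using Z E0 by (intro divide_nonneg_pos Bochner_Integration.integral_nonneg) auto
    have at: "a_tilde \<gamma> b \<rho> N \<theta> = 1 / sqrt (real N) + sqrt a" by (simp add: a_tilde_def a_def)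
    have at0: "0 \<le> 1 / sqrt (real N) + sqrt a" using a by simp
    show ?thesis
    \<comment> \<open>\<open>3 \<le> N\<close> leaves at least two coordinates after removing
      \<open>d\<close>, as integration by parts requires; the second condition is
      \<open>big\<close>.\<close>
    proof (cases "3 \<le> N \<and> 6 / \<epsilon> \<le> sqrt (real N)")
      case True
      have J: "finite ?J" "d \<notin> ?J" "2 \<le> card ?J" "?I = insert d ?J" using dN True by auto
      have NI: "real N = real (card ?I)" by simp
      have wd: "\<gamma> N d \<in> {0..b}" using w dN by auto
      have big: "3 / sqrt (real N) \<le> \<epsilon> / 2"
        using True \<epsilon>(1) N by (simp add: field_simps)
      have conc: "(\<integral>g. (rayleigh (\<gamma> N) ?I g - v)\<^sup>2 * E1 g \<partial>gaussian ?I) \<le> a * (\<integral>g. E1 g \<partial>gaussian ?I)"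
        unfolding rate Z_def[symmetric] using Z by simp
      note dist = gibbs_weight_distance[OF J NI w b c(1,2) c(3)[OF wd] \<epsilon> \<delta> big a E1_def E2_def conc]
      have "\<bar>gibbs_mean N (hamiltonian \<gamma> N) \<theta> f - gibbs_mean N (decoupled_hamiltonian \<gamma> b \<rho> N \<theta> d) \<theta> f\<bar>
          \<le> 2 * ?F * ((\<integral>g. \<bar>E1 g - E2 g\<bar> \<partial>gaussian ?I) / Z)"
        unfolding m1 m2 Z_def
        by (rule weighted_mean_diff_le[OF fm fF F int1 dist(1) E0 Z[unfolded Z_def]])
      also have "\<dots> \<le> 2 * ?F * (C * (1 / sqrt (real N) + sqrt a))"
        using dist(2) Z F unfolding C_def[symmetric] Z_def[symmetric]
        by (intro mult_left_mono) (simp_all add: pos_divide_le_eq)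
      also have "\<dots> = 2 * C * ?F * (1 / sqrt (real N) + sqrt a)" by simp
      also have "\<dots> \<le> K * ?F * (1 / sqrt (real N) + sqrt a)"
        using F at0 \<epsilon>(1) by (intro mult_right_mono) (auto simp: K_def)
      finally show ?thesis unfolding at .
    next
      case False
      then have "\<not> 3 \<le> N \<or> \<not> 6 / \<epsilon> \<le> sqrt (real N)" by simp
      then have small: "sqrt (real N) \<le> 6 / \<epsilon> + 2"
      proof
        assume "\<not> 3 \<le> N"
        then have "sqrt (real N) \<le> sqrt 4" by (intro real_sqrt_le_mono) auto
        also have "\<dots> \<le> 6 / \<epsilon> + 2" using \<epsilon>(1) by simp
        finally show ?thesis .
      next
        assume "\<not> 6 / \<epsilon> \<le> sqrt (real N)"
        then show ?thesis by simp
      qed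
      \<comment> \<open>With \<open>N\<close> bounded, the term \<open>1 / sqrt N\<close> of the
        rate is bounded below, so the trivial bound of twice the sup norm suffices.\<close>
      have "1 \<le> (6 / \<epsilon> + 2) * (1 / sqrt (real N))" using small N by (simp add: field_simps)
      also have "\<dots> \<le> (C + 6 / \<epsilon> + 2) * (1 / sqrt (real N) + sqrt a)"
        using a C \<epsilon>(1) by (intro mult_mono) auto
      finally have one: "1 \<le> (C + 6 / \<epsilon> + 2) * (1 / sqrt (real N) + sqrt a)" .
      have "\<bar>gibbs_mean N (hamiltonian \<gamma> N) \<theta> f\<bar> \<le> ?F"
        unfolding m1 Z_def by (rule weighted_mean_abs_le(3)[OF fm fF F E0(1)])
      moreover have "\<bar>gibbs_mean N (decoupled_hamiltonian \<gamma> b \<rho> N \<theta> d) \<theta> f\<bar> \<le> ?F"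
        unfolding m2 by (rule weighted_mean_abs_le(3)[OF fm fF F E0(2)])
      ultimately have "\<bar>gibbs_mean N (hamiltonian \<gamma> N) \<theta> f - gibbs_mean N (decoupled_hamiltonian \<gamma> b \<rho> N \<theta> d) \<theta> f\<bar>
          \<le> 2 * ?F * 1"
        by linarith
      also have "\<dots> \<le> 2 * ?F * ((C + 6 / \<epsilon> + 2) * (1 / sqrt (real N) + sqrt a))"
        using one F by (intro mult_left_mono) auto
      also have "\<dots> = K * ?F * (1 / sqrt (real N) + sqrt a)" by (simp only: K_def mult_ac)
      finally show ?thesis unfolding at .
    qed
  qed
  ultimately show ?thesis by blast
qed

end
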